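(* Let $K$ be a field, $S=K[x_1,\ldots,x_n]$, and let $\operatorname{Mon}(S)$ be the set of monomials of $S$. Let $0\subset I_1\subsetneq J_1\subset S$ and $0\subset I_2\subsetneq J_2\subset S$ be monomial ideals. Assume that there exists a function $\Phi:\operatorname{Mon}(S)\to\operatorname{Mon}(S)$ such that the following conditions are satisfied: \begin{enumerate} \item[(i)] for every monomial $u\in\operatorname{Mon}(S)$, $u\in I_1$ if and only if $\Phi(u)\in I_2$; \item[(ii)] for every monomial $u\in\operatorname{Mon}(S)$, $u\in J_1$ if and only if $\Phi(u)\in J_2$; \item[(iii)] for every Stanley space $uK[Z]\subset S$ (with $u\in\operatorname{Mon}(S)$ and $Z\subset\{x_1,\ldots,x_n\}$) and every monomial $v\in\operatorname{Mon}(S)$, $v\in uK[Z]$ if and only if $\Phi(v)\in\Phi(u)K[Z]$. \end{enumerate} Then $\operatorname{slength}(J_1/I_1)\leq\operatorname{slength}(J_2/I_2)$.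
   Context: Let $M$ be a finitely generated $\mathbb Z^n$-graded $S$-module, $S=K[x_1,\ldots,x_n]$. A Stanley decomposition of $M$ is a finite direct sum of $K$-vector spaces $\mathcal D: M=\bigoplus_{i=1}^r m_iK[Z_i]$, where each $m_i\in M$ is homogeneous, $Z_i\subset\{x_1,\ldots,x_n\}$, and $m_iK[Z_i]$ is a free $K[Z_i]$-module. Its length is $\operatorname{slength}(\mathcal D)=r$, and the Stanley length of $M$ is $\operatorname{slength}(M)=\min\{\operatorname{slength}(\mathcal D):\mathcal D\text{ is a Stanley decomposition of }M\}$. *)

theory Defs
  imports "HOL-Library.Poly_Mapping" "HOL-Library.FuncSet"
    "HOL-Algebra.Algebraic_Closure_Type" "HOL-Algebra.QuotRing" "HOL-Algebra.Module"
begin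

text \<open>
  The variables are indexed by a finite type \<open>'n\<close>, so \<open>n = CARD('n)\<close> is arbitrary (and at least 1).
  An exponent vector is an element of \<open>'n \<Rightarrow>\<^sub>0 nat\<close>, a set of variables is an element of \<open>'n set\<close>.
\<close>

type_synonym ('n, 'k) mpoly = "('n \<Rightarrow>\<^sub>0 nat) \<Rightarrow>\<^sub>0 'k"

abbreviation mpoly_ring :: "('n::finite, 'k::field) mpoly ring" where
  "mpoly_ring \<equiv> ring_of_type_algebra"

definition Mon :: "('n::finite, 'k::field) mpoly set" where
  "Mon = {Poly_Mapping.single a 1 | a. True}"

definition monomial_ideal :: "('n::finite, 'k::field) mpoly set \<Rightarrow> bool" where
  "monomial_ideal I \<longleftrightarrow> (\<exists>G\<subseteq>Mon. I = Idl\<^bsub>mpoly_ring\<^esub> G)"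

text \<open>\<open>K[Z]\<close>, as a subset of \<open>S\<close>.\<close>

definition poly_in :: "'n set \<Rightarrow> ('n::finite, 'k::field) mpoly set" where
  "poly_in Z = {f. \<forall>a\<in>Poly_Mapping.keys f. Poly_Mapping.keys a \<subseteq> Z}"

definition Stanley_space :: "('n::finite, 'k::field) mpoly \<Rightarrow> 'n set \<Rightarrow> ('n, 'k) mpoly set" where
  "Stanley_space u Z = {u * f | f. f \<in> poly_in Z}"


subsection \<open>Graded modules\<close>

text \<open>
  \<open>M\<close> is the internal direct sum of the family of additive subgroups \<open>V\<close>: every element is in a
  unique way a sum of elements of the \<open>V i\<close>, almost all of them zero. (The finite sum of \<^const>\<open>finsum\<close>
  has a meaning for finite index sets only, so it runs over the support.)
\<close>

definition direct_sum_of :: "('m, 'x) ring_scheme \<Rightarrow> 'i set \<Rightarrow> ('i \<Rightarrow> 'm set) \<Rightarrow> bool" where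
  "direct_sum_of M A V \<longleftrightarrow>
     (\<forall>i\<in>A. V i \<subseteq> carrier M) \<and>
     (\<forall>x\<in>carrier M. \<exists>!w. w \<in> (\<Pi>\<^sub>E i\<in>A. V i) \<and> finite {i\<in>A. w i \<noteq> \<zero>\<^bsub>M\<^esub>} \<and>
        x = (\<Oplus>\<^bsub>M\<^esub>i\<in>{i\<in>A. w i \<noteq> \<zero>\<^bsub>M\<^esub>}. w i))"

locale Zn_graded_module =
  Module.module "mpoly_ring :: ('n::finite, 'k::field) mpoly ring" M
  for M :: "(('n::finite, 'k::field) mpoly, 'm) module" (structure) +
  fixes gr :: "('n \<Rightarrow> int) \<Rightarrow> 'm set"
  assumes gr_subgroup: "additive_subgroup (gr d) M"
    and gr_direct_sum: "direct_sum_of M UNIV gr"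
    and gr_smult: "x \<in> gr d \<Longrightarrow>
      Poly_Mapping.single a c \<odot>\<^bsub>M\<^esub> x \<in> gr (\<lambda>i. d i + int (Poly_Mapping.lookup a i))"

definition homogeneous :: "('d \<Rightarrow> 'm set) \<Rightarrow> 'm \<Rightarrow> bool" where
  "homogeneous gr x \<longleftrightarrow> (\<exists>d. x \<in> gr d)"

text \<open>
  Freeness over a subring \<open>A\<close> of the scalars, for an \<open>A\<close>-submodule \<open>N\<close> of \<open>M\<close>:
  \<open>N\<close> has an \<open>A\<close>-basis \<open>B\<close>.
\<close>

definition free_over :: "'r::zero set \<Rightarrow> ('r, 'm, 'x) module_scheme \<Rightarrow> 'm set \<Rightarrow> bool" where
  "free_over A M N \<longleftrightarrow> (\<exists>B\<subseteq>N.
     (\<forall>F c. finite F \<and> F \<subseteq> B \<and> c \<in> F \<rightarrow> A \<and> (\<Oplus>\<^bsub>M\<^esub>b\<in>F. c b \<odot>\<^bsub>M\<^esub> b) = \<zero>\<^bsub>M\<^esub>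
        \<longrightarrow> (\<forall>b\<in>F. c b = 0)) \<and>
     (\<forall>x\<in>N. \<exists>F c. finite F \<and> F \<subseteq> B \<and> c \<in> F \<rightarrow> A \<and> x = (\<Oplus>\<^bsub>M\<^esub>b\<in>F. c b \<odot>\<^bsub>M\<^esub> b)))"

text \<open>\<open>mK[Z]\<close>, for an element \<open>m\<close> of the module \<open>M\<close>.\<close>

definition cyclic_part ::
  "(('n::finite, 'k::field) mpoly, 'm, 'x) module_scheme \<Rightarrow> 'm \<Rightarrow> 'n set \<Rightarrow> 'm set" where
  "cyclic_part M m Z = {f \<odot>\<^bsub>M\<^esub> m | f. f \<in> poly_in Z}"

definition Stanley_decomposition ::
  "(('n::finite, 'k::field) mpoly, 'm, 'x) module_scheme \<Rightarrow> (('n \<Rightarrow> int) \<Rightarrow> 'm set) \<Rightarrow>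
   ('m \<times> 'n set) list \<Rightarrow> bool" where
  "Stanley_decomposition M gr D \<longleftrightarrow>
     (\<forall>(m, Z)\<in>set D. m \<in> carrier M \<and> homogeneous gr m \<and>
        free_over (poly_in Z :: ('n, 'k) mpoly set) M (cyclic_part M m Z)) \<and>
     direct_sum_of M {..<length D} (\<lambda>i. cyclic_part M (fst (D ! i)) (snd (D ! i)))"

definition slength ::
  "(('n::finite, 'k::field) mpoly, 'm, 'x) module_scheme \<Rightarrow> (('n \<Rightarrow> int) \<Rightarrow> 'm set) \<Rightarrow> nat" where
  "slength M gr = (LEAST r. \<exists>D. Stanley_decomposition M gr D \<and> length D = r)"


subsection \<open>The graded module \<open>J/I\<close>\<close>

text \<open>
  Addition and zero are those of \<^const>\<open>FactRing\<close>. The fields \<open>mult\<close> and \<open>one\<close> are part of every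
  module record, but play no role for modules.
\<close>

definition quot_module ::
  "('n::finite, 'k::field) mpoly set \<Rightarrow> ('n, 'k) mpoly set \<Rightarrow>
   (('n, 'k) mpoly, ('n, 'k) mpoly set) module" where
  "quot_module J I =
     \<lparr>carrier = {I +>\<^bsub>mpoly_ring\<^esub> p | p. p \<in> J},
      monoid.mult = rcoset_mult mpoly_ring I, one = I +>\<^bsub>mpoly_ring\<^esub> 1,
      zero = I, add = set_add mpoly_ring,
      module.smult = (\<lambda>f C. \<Union>p\<in>C. I +>\<^bsub>mpoly_ring\<^esub> (f * p))\<rparr>"

text \<open>The classes of the elements of \<open>J\<close> all of whose terms have degree \<open>d\<close>.\<close>

definition quot_grading ::
  "('n::finite, 'k::field) mpoly set \<Rightarrow> ('n, 'k) mpoly set \<Rightarrow>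
   ('n \<Rightarrow> int) \<Rightarrow> ('n, 'k) mpoly set set" where
  "quot_grading J I d =
     {I +>\<^bsub>mpoly_ring\<^esub> p | p. p \<in> J \<and>
        (\<forall>a\<in>Poly_Mapping.keys p. \<forall>i. int (Poly_Mapping.lookup a i) = d i)}"


subsection \<open>\<open>J/I\<close> is a graded module\<close>

lemma mpoly_ring_simps [simp]:
  "carrier mpoly_ring = UNIV" "x \<otimes>\<^bsub>mpoly_ring\<^esub> y = x * y" "\<one>\<^bsub>mpoly_ring\<^esub> = 1"
  "\<zero>\<^bsub>mpoly_ring\<^esub> = 0" "x \<oplus>\<^bsub>mpoly_ring\<^esub> y = x + y"
  by (simp_all add: ring_of_type_algebra_def)

lemma cring_mpoly_ring: "cring (mpoly_ring :: ('n::finite, 'k::field) mpoly ring)"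
  by (rule cring_from_type_algebra)

lemma a_minus_mpoly_ring [simp]: "\<ominus>\<^bsub>mpoly_ring\<^esub> x = - (x :: ('n::finite, 'k::field) mpoly)"
proof -
  interpret cring "mpoly_ring :: ('n, 'k) mpoly ring" by (rule cring_mpoly_ring)
  show ?thesis using minus_equality[of "-x" x] by simp
qed

lemma ideal_mpoly_ring_iff:
  fixes I :: "('n::finite, 'k::field) mpoly set"
  shows "ideal I mpoly_ring \<longleftrightarrow> 0 \<in> I \<and> (\<forall>p\<in>I. \<forall>q\<in>I. p + q \<in> I) \<and> (\<forall>p\<in>I. \<forall>f. f * p \<in> I)"
proof
  assume "ideal I mpoly_ring"
  then interpret ideal I mpoly_ring .
  show "0 \<in> I \<and> (\<forall>p\<in>I. \<forall>q\<in>I. p + q \<in> I) \<and> (\<forall>p\<in>I. \<forall>f. f * p \<in> I)"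
    using additive_subgroup.zero_closed[OF additive_subgroup_axioms]
      additive_subgroup.a_closed[OF additive_subgroup_axioms] I_l_closed by auto
next
  assume *: "0 \<in> I \<and> (\<forall>p\<in>I. \<forall>q\<in>I. p + q \<in> I) \<and> (\<forall>p\<in>I. \<forall>f. f * p \<in> I)"
  have neg: "- p \<in> I" if "p \<in> I" for p using * that by (metis mult_minus1)
  interpret cring "mpoly_ring :: ('n, 'k) mpoly ring" by (rule cring_mpoly_ring)
  show "ideal I mpoly_ring"
  proof (rule idealI)
    show "subgroup I (add_monoid mpoly_ring)"
      by (rule add.subgroupI) (use * neg in \<open>auto simp flip: a_inv_def\<close>)
  qed (use * ring_axioms in \<open>auto simp: mult.commute\<close>)
qed

lemma coset_eq: "I +>\<^bsub>mpoly_ring\<^esub> p = {i + p | i. i \<in> I}"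
  by (auto simp: a_r_coset_def' )

context
  fixes I :: "('n::finite, 'k::field) mpoly set"
  assumes mI: "monomial_ideal I"
begin

lemma monomial_ideal_ideal: "ideal I mpoly_ring"
proof -
  interpret cring "mpoly_ring :: ('n, 'k) mpoly ring" by (rule cring_mpoly_ring)
  show ?thesis using mI genideal_ideal by (auto simp: monomial_ideal_def)
qed

lemma monomial_ideal_closed: "0 \<in> I" "p \<in> I \<Longrightarrow> q \<in> I \<Longrightarrow> p + q \<in> I" "p \<in> I \<Longrightarrow> f * p \<in> I"
  "p \<in> I \<Longrightarrow> - p \<in> I" "p \<in> I \<Longrightarrow> q \<in> I \<Longrightarrow> p - q \<in> I"
proof -
  show *: "0 \<in> I" "p \<in> I \<Longrightarrow> q \<in> I \<Longrightarrow> p + q \<in> I" "\<And>p f. p \<in> I \<Longrightarrow> f * p \<in> I" for p q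
    using monomial_ideal_ideal by (auto simp: ideal_mpoly_ring_iff)
  show **: "p \<in> I \<Longrightarrow> - p \<in> I" for p using *(3)[of p "-1"] by simp
  show "p \<in> I \<Longrightarrow> q \<in> I \<Longrightarrow> p - q \<in> I" using *(2)[of p "-q"] **[of q] by simp
qed

lemma monomial_ideal_sum: "(\<And>i. i \<in> A \<Longrightarrow> f i \<in> I) \<Longrightarrow> sum f A \<in> I"
  by (induction A rule: infinite_finite_induct) (auto simp: monomial_ideal_closed(1,2))

lemma monomial_ideal_term:
  assumes "p \<in> I"
  shows "Poly_Mapping.single a (Poly_Mapping.lookup p a) \<in> I"
proof -
  obtain G where G: "G \<subseteq> Mon" "I = Idl\<^bsub>mpoly_ring\<^esub> G" using mI by (auto simp: monomial_ideal_def)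
  interpret cring "mpoly_ring :: ('n, 'k) mpoly ring" by (rule cring_mpoly_ring)
  have GI: "G \<subseteq> I" using genideal_self[of G] G by simp
  define U where "U = {b. Poly_Mapping.single b (1::'k) \<in> I}"
  have U_add: "b + d \<in> U" if "d \<in> U" for b d
    using monomial_ideal_closed(3)[of "Poly_Mapping.single d 1" "Poly_Mapping.single b 1"] that
    by (simp add: U_def mult_single)
  define T where "T = {q::('n,'k) mpoly. Poly_Mapping.keys q \<subseteq> U}"
  have "ideal T mpoly_ring"
    unfolding ideal_mpoly_ring_iff
  proof (intro conjI ballI allI)
    show "0 \<in> T" by (simp add: T_def)
    show "p + q \<in> T" if "p \<in> T" "q \<in> T" for p q
      using that Poly_Mapping.keys_add[of p q] by (auto simp: T_def)
    show "f * q \<in> T" if "q \<in> T" for f q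
      using that keys_mult[of f q] U_add by (fastforce simp: T_def)
  qed
  moreover have "G \<subseteq> T"
  proof
    fix g assume "g \<in> G"
    then obtain b where "g = Poly_Mapping.single b 1" "g \<in> I" using G GI by (auto simp: Mon_def)
    then show "g \<in> T" by (simp add: T_def U_def)
  qed
  ultimately have "I \<subseteq> T" using genideal_minimal G by metis
  then have keys: "Poly_Mapping.keys p \<subseteq> U" using assms by (auto simp: T_def)
  show ?thesis
  proof (cases "a \<in> Poly_Mapping.keys p")
    case True
    then have "Poly_Mapping.single a 1 \<in> I" using keys by (auto simp: U_def)
    from monomial_ideal_closed(3)[OF this, of "Poly_Mapping.single 0 (Poly_Mapping.lookup p a)"]
    show ?thesis by (simp add: mult_single)
  next
    case False
    then show ?thesis by (simp add: in_keys_iff monomial_ideal_closed(1))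
  qed
qed

lemma coset_mem_self: "p \<in> I +>\<^bsub>mpoly_ring\<^esub> p"
  by (simp add: coset_eq monomial_ideal_closed(1))

lemma coset_eq_iff: "I +>\<^bsub>mpoly_ring\<^esub> p = I +>\<^bsub>mpoly_ring\<^esub> q \<longleftrightarrow> p - q \<in> I"
proof
  assume "I +>\<^bsub>mpoly_ring\<^esub> p = I +>\<^bsub>mpoly_ring\<^esub> q"
  then show "p - q \<in> I" using coset_mem_self[of p] by (auto simp: coset_eq)
next
  assume a: "p - q \<in> I"
  have "i + (p - q) \<in> I" "i - (p - q) \<in> I" if "i \<in> I" for i
    using that a monomial_ideal_closed by auto
  moreover have "i + p = (i + (p - q)) + q" "i + q = (i - (p - q)) + p" for i
    by simp_all
  ultimately show "I +>\<^bsub>mpoly_ring\<^esub> p = I +>\<^bsub>mpoly_ring\<^esub> q"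
    unfolding coset_eq by blast
qed

lemma coset_eq_I_iff: "I +>\<^bsub>mpoly_ring\<^esub> p = I \<longleftrightarrow> p \<in> I"
  using coset_eq_iff[of p 0] by (simp add: coset_eq)

lemma coset_zero: "I +>\<^bsub>mpoly_ring\<^esub> 0 = I"
  by (simp add: coset_eq_I_iff monomial_ideal_closed(1))

lemma coset_add: "(I +>\<^bsub>mpoly_ring\<^esub> p) <+>\<^bsub>mpoly_ring\<^esub> (I +>\<^bsub>mpoly_ring\<^esub> q) = I +>\<^bsub>mpoly_ring\<^esub> (p + q)"
proof (rule Set.set_eqI, rule iffI)
  fix x assume "x \<in> (I +>\<^bsub>mpoly_ring\<^esub> p) <+>\<^bsub>mpoly_ring\<^esub> (I +>\<^bsub>mpoly_ring\<^esub> q)"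
  then obtain i1 i2 where i: "i1 \<in> I" "i2 \<in> I" "x = (i1 + p) + (i2 + q)"
    by (auto simp: coset_eq set_add_def')
  then have "x = (i1 + i2) + (p + q)" by simp
  then show "x \<in> I +>\<^bsub>mpoly_ring\<^esub> (p + q)"
    using monomial_ideal_closed(2)[OF i(1,2)] unfolding coset_eq by blast
next
  fix x assume "x \<in> I +>\<^bsub>mpoly_ring\<^esub> (p + q)"
  then obtain i where i: "i \<in> I" "x = i + (p + q)" by (auto simp: coset_eq)
  then have x: "x = (i + p) \<oplus>\<^bsub>mpoly_ring\<^esub> q" by (simp add: add.assoc)
  have "i + p \<in> I +>\<^bsub>mpoly_ring\<^esub> p" using i(1) unfolding coset_eq by blast
  then show "x \<in> (I +>\<^bsub>mpoly_ring\<^esub> p) <+>\<^bsub>mpoly_ring\<^esub> (I +>\<^bsub>mpoly_ring\<^esub> q)"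
    using coset_mem_self[of q] x unfolding set_add_def' by blast
qed

lemma coset_smult:
  "(\<Union>q\<in>I +>\<^bsub>mpoly_ring\<^esub> p. I +>\<^bsub>mpoly_ring\<^esub> (f * q)) = I +>\<^bsub>mpoly_ring\<^esub> (f * p)"
proof -
  have "I +>\<^bsub>mpoly_ring\<^esub> (f * q) = I +>\<^bsub>mpoly_ring\<^esub> (f * p)" if q: "q \<in> I +>\<^bsub>mpoly_ring\<^esub> p" for q
  proof -
    from q obtain i where i: "i \<in> I" "q = i + p" by (auto simp: coset_eq)
    have "f * q - f * p = f * i" using i by (simp add: algebra_simps)
    then show ?thesis using i monomial_ideal_closed(3) by (simp add: coset_eq_iff)
  qed
  then show ?thesis using coset_mem_self[of p] by blast
qed

end

context
  fixes I J :: "('n::finite, 'k::field) mpoly set"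
  assumes mI: "monomial_ideal I" and mJ: "monomial_ideal J" and IJ: "I \<subseteq> J"
begin

lemma quot_module_simps:
  "carrier (quot_module J I) = {I +>\<^bsub>mpoly_ring\<^esub> p | p. p \<in> J}"
  "\<zero>\<^bsub>quot_module J I\<^esub> = I"
  "(I +>\<^bsub>mpoly_ring\<^esub> p) \<oplus>\<^bsub>quot_module J I\<^esub> (I +>\<^bsub>mpoly_ring\<^esub> q) = I +>\<^bsub>mpoly_ring\<^esub> (p + q)"
  "f \<odot>\<^bsub>quot_module J I\<^esub> (I +>\<^bsub>mpoly_ring\<^esub> p) = I +>\<^bsub>mpoly_ring\<^esub> (f * p)"
  using coset_add[OF mI] coset_smult[OF mI] by (simp_all add: quot_module_def)

lemmas J_closed = monomial_ideal_closed[OF mJ]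

lemma abelian_group_quot_module: "abelian_group (quot_module J I)"
proof (rule abelian_groupI)
  fix x y z
  assume "x \<in> carrier (quot_module J I)" "y \<in> carrier (quot_module J I)" "z \<in> carrier (quot_module J I)"
  then obtain p q r where "p \<in> J" "q \<in> J" "r \<in> J" "x = I +>\<^bsub>mpoly_ring\<^esub> p" "y = I +>\<^bsub>mpoly_ring\<^esub> q"
     "z = I +>\<^bsub>mpoly_ring\<^esub> r"
    by (auto simp: quot_module_simps)
  then show "x \<oplus>\<^bsub>quot_module J I\<^esub> y \<oplus>\<^bsub>quot_module J I\<^esub> z = x \<oplus>\<^bsub>quot_module J I\<^esub> (y \<oplus>\<^bsub>quot_module J I\<^esub> z)"
     by (simp add: quot_module_simps add.assoc)
next
  fix x y
  assume "x \<in> carrier (quot_module J I)" "y \<in> carrier (quot_module J I)"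
  then obtain p q where *: "p \<in> J" "q \<in> J" "x = I +>\<^bsub>mpoly_ring\<^esub> p" "y = I +>\<^bsub>mpoly_ring\<^esub> q"
    by (auto simp: quot_module_simps)
  then show "x \<oplus>\<^bsub>quot_module J I\<^esub> y = y \<oplus>\<^bsub>quot_module J I\<^esub> x"
     by (simp add: quot_module_simps add.commute)
  show "x \<oplus>\<^bsub>quot_module J I\<^esub> y \<in> carrier (quot_module J I)"
    using * J_closed(2) by (auto simp: quot_module_simps)
next
  show "\<zero>\<^bsub>quot_module J I\<^esub> \<in> carrier (quot_module J I)"
    using coset_zero[OF mI] J_closed(1) by (auto simp: quot_module_simps)
next
  fix x
  assume "x \<in> carrier (quot_module J I)"
  then obtain p where *: "p \<in> J" "x = I +>\<^bsub>mpoly_ring\<^esub> p"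
    by (auto simp: quot_module_simps)
  show "\<zero>\<^bsub>quot_module J I\<^esub> \<oplus>\<^bsub>quot_module J I\<^esub> x = x"
    using quot_module_simps(3)[of 0 p] * coset_zero[OF mI] by (simp add: quot_module_simps(2))
  show "\<exists>y\<in>carrier (quot_module J I). y \<oplus>\<^bsub>quot_module J I\<^esub> x = \<zero>\<^bsub>quot_module J I\<^esub>"
    using * J_closed(4)[of p] quot_module_simps(3)[of "-p" p] coset_zero[OF mI]
    by (auto simp: quot_module_simps(1,2))
qed

lemma module_quot_module: "Module.module mpoly_ring (quot_module J I)"
proof (rule moduleI)
  show "cring (mpoly_ring :: ('n, 'k) mpoly ring)" by (rule cring_mpoly_ring)
  show "abelian_group (quot_module J I)" by (rule abelian_group_quot_module)
next
  fix f and x assume "x \<in> carrier (quot_module J I)"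
  then obtain p where "p \<in> J" "x = I +>\<^bsub>mpoly_ring\<^esub> p" by (auto simp: quot_module_simps)
  then show "f \<odot>\<^bsub>quot_module J I\<^esub> x \<in> carrier (quot_module J I)"
    using J_closed(3) by (auto simp: quot_module_simps)
qed (auto simp: quot_module_simps algebra_simps)

lemma finsum_coset:
  assumes "finite A" "\<And>i. i \<in> A \<Longrightarrow> p i \<in> J"
  shows "(\<Oplus>\<^bsub>quot_module J I\<^esub>i\<in>A. I +>\<^bsub>mpoly_ring\<^esub> p i) = I +>\<^bsub>mpoly_ring\<^esub> (\<Sum>i\<in>A. p i)"
proof -
  interpret abelian_group "quot_module J I" by (rule abelian_group_quot_module)
  show ?thesis
    using assms
  proof (induction A rule: finite_induct)
    case empty
    then show ?case by (simp add: quot_module_simps coset_zero[OF mI])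
  next
    case (insert i A)
    have "(\<lambda>i. I +>\<^bsub>mpoly_ring\<^esub> p i) \<in> A \<rightarrow> carrier (quot_module J I)"
      "I +>\<^bsub>mpoly_ring\<^esub> p i \<in> carrier (quot_module J I)"
      using insert.prems by (auto simp: quot_module_simps)
    then show ?case using insert by (simp add: quot_module_simps)
  qed
qed

lemma direct_sum_of_quot_grading: "direct_sum_of (quot_module J I) UNIV (quot_grading J I)"
  unfolding direct_sum_of_def
proof (intro conjI ballI)
  show "quot_grading J I d \<subseteq> carrier (quot_module J I)" for d
    by (auto simp: quot_grading_def quot_module_simps)
next
  fix x assume "x \<in> carrier (quot_module J I)"
  then obtain p where p: "p \<in> J" "x = I +>\<^bsub>mpoly_ring\<^esub> p" by (auto simp: quot_module_simps)
  define deg where "deg = (\<lambda>(a::'n \<Rightarrow>\<^sub>0 nat) i. int (Poly_Mapping.lookup a i))"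
  define t where "t q d = (\<Sum>a | a \<in> Poly_Mapping.keys q \<and> deg a = d.
      Poly_Mapping.single a (Poly_Mapping.lookup q a))" for q :: "('n,'k) mpoly" and d
  have lookup_t: "Poly_Mapping.lookup (t q d) a = (if deg a = d then Poly_Mapping.lookup q a else 0)" for q d a
    by (auto simp: t_def lookup_sum lookup_single when_def in_keys_iff if_distrib sum.delta)
  have t_J: "t q d \<in> J" if "q \<in> J" for q d
    unfolding t_def by (rule monomial_ideal_sum[OF mJ]) (use monomial_ideal_term[OF mJ that] in auto)
  have t_I: "t q d \<in> I" if "q \<in> I" for q d
    unfolding t_def by (rule monomial_ideal_sum[OF mI]) (use monomial_ideal_term[OF mI that] in auto)
  have t_diff: "t (q - r) d = t q d - t r d" for q r d
    by (rule poly_mapping_eqI) (auto simp: lookup_t lookup_minus)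
  have t_sum: "t (\<Sum>i\<in>A. q i) d = (\<Sum>i\<in>A. t (q i) d)" for q d and A :: "('n \<Rightarrow> int) set"
    by (rule poly_mapping_eqI) (auto simp: lookup_t lookup_sum)
  have homog: "quot_grading J I d = {I +>\<^bsub>mpoly_ring\<^esub> q | q. q \<in> J \<and> t q d = q}" for d
  proof -
    have "(\<forall>a\<in>Poly_Mapping.keys q. \<forall>i. int (Poly_Mapping.lookup a i) = d i) \<longleftrightarrow> t q d = q" for q
    proof -
      have "t q d = q \<longleftrightarrow> (\<forall>a. Poly_Mapping.lookup (t q d) a = Poly_Mapping.lookup q a)"
        by (metis poly_mapping_eqI)
      also have "\<dots> \<longleftrightarrow> (\<forall>a\<in>Poly_Mapping.keys q. deg a = d)" by (auto simp: lookup_t in_keys_iff)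
      finally show ?thesis by (simp add: deg_def fun_eq_iff)
    qed
    then show ?thesis by (simp add: quot_grading_def)
  qed
  have t_t: "t (t q d) d' = (if d = d' then t q d else 0)" for q d d'
    by (rule poly_mapping_eqI) (auto simp: lookup_t)
  define D where "D = {d. I +>\<^bsub>mpoly_ring\<^esub> t p d \<noteq> I}"
  have D_sub: "D \<subseteq> deg ` Poly_Mapping.keys p"
  proof
    fix d assume "d \<in> D"
    then have "I +>\<^bsub>mpoly_ring\<^esub> t p d \<noteq> I +>\<^bsub>mpoly_ring\<^esub> 0"
      unfolding D_def coset_zero[OF mI] by blast
    then have "t p d \<noteq> 0" by metis
    then obtain a where "Poly_Mapping.lookup (t p d) a \<noteq> 0"
      using poly_mapping_eqI[of "t p d" 0] by auto
    then have "deg a = d" "a \<in> Poly_Mapping.keys p" by (auto simp: lookup_t in_keys_iff split: if_splits)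
    then show "d \<in> deg ` Poly_Mapping.keys p" by blast
  qed
  then have "finite D" using finite_surj[OF finite_keys] by blast
  show "\<exists>!w. w \<in> (\<Pi>\<^sub>E d\<in>UNIV. quot_grading J I d) \<and>
             finite {d \<in> UNIV. w d \<noteq> \<zero>\<^bsub>quot_module J I\<^esub>} \<and>
             x = (\<Oplus>\<^bsub>quot_module J I\<^esub>d\<in>{d \<in> UNIV. w d \<noteq> \<zero>\<^bsub>quot_module J I\<^esub>}. w d)"
  proof (rule ex1I[of _ "\<lambda>d. I +>\<^bsub>mpoly_ring\<^esub> t p d"], intro conjI)
    show "(\<lambda>d. I +>\<^bsub>mpoly_ring\<^esub> t p d) \<in> (\<Pi>\<^sub>E d\<in>UNIV. quot_grading J I d)"
    proof (rule PiE_I)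
      show "I +>\<^bsub>mpoly_ring\<^esub> t p d \<in> quot_grading J I d" for d
        unfolding homog mem_Collect_eq using t_J[OF p(1), of d] t_t[of p d d] by (intro exI[of _ "t p d"]) simp
    qed simp
    have eq: "{d \<in> UNIV. I +>\<^bsub>mpoly_ring\<^esub> t p d \<noteq> \<zero>\<^bsub>quot_module J I\<^esub>} = D"
      by (simp add: D_def quot_module_simps)
    show "finite {d \<in> UNIV. I +>\<^bsub>mpoly_ring\<^esub> t p d \<noteq> \<zero>\<^bsub>quot_module J I\<^esub>}"
      unfolding eq by fact
    have "p - (\<Sum>d\<in>D. t p d) = (\<Sum>d\<in>deg ` Poly_Mapping.keys p - D. t p d)"
    proof -
      have "p = (\<Sum>d\<in>deg ` Poly_Mapping.keys p. t p d)"
        by (rule poly_mapping_eqI) (auto simp: lookup_sum lookup_t in_keys_iff sum.delta' image_iff)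
      then have "p = (\<Sum>d\<in>deg ` Poly_Mapping.keys p - D. t p d) + (\<Sum>d\<in>D. t p d)"
        using sum.subset_diff[OF D_sub, of "t p"] by simp
      then show ?thesis by (metis add_diff_cancel_right')
    qed
    moreover have "\<dots> \<in> I"
      by (rule monomial_ideal_sum[OF mI]) (auto simp: D_def coset_eq_I_iff[OF mI])
    ultimately show "x = (\<Oplus>\<^bsub>quot_module J I\<^esub>d\<in>{d \<in> UNIV. I +>\<^bsub>mpoly_ring\<^esub> t p d \<noteq> \<zero>\<^bsub>quot_module J I\<^esub>}.
        I +>\<^bsub>mpoly_ring\<^esub> t p d)"
      unfolding eq p(2) using \<open>finite D\<close> t_J[OF p(1)] by (simp add: finsum_coset coset_eq_iff[OF mI])
  next
    fix w
    assume w: "w \<in> (\<Pi>\<^sub>E d\<in>UNIV. quot_grading J I d) \<and>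
             finite {d \<in> UNIV. w d \<noteq> \<zero>\<^bsub>quot_module J I\<^esub>} \<and>
             x = (\<Oplus>\<^bsub>quot_module J I\<^esub>d\<in>{d \<in> UNIV. w d \<noteq> \<zero>\<^bsub>quot_module J I\<^esub>}. w d)"
    define F where "F = {d \<in> UNIV. w d \<noteq> \<zero>\<^bsub>quot_module J I\<^esub>}"
    have "\<forall>d. \<exists>q. q \<in> J \<and> t q d = q \<and> w d = I +>\<^bsub>mpoly_ring\<^esub> q"
    proof
      fix d
      have "w d \<in> quot_grading J I d" using PiE_mem[OF conjunct1[OF w] UNIV_I] .
      then show "\<exists>q. q \<in> J \<and> t q d = q \<and> w d = I +>\<^bsub>mpoly_ring\<^esub> q"
        unfolding homog by blast
    qed
    from choice[OF this] obtain q where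
      q: "\<And>d. q d \<in> J" "\<And>d. t (q d) d = q d" "\<And>d. w d = I +>\<^bsub>mpoly_ring\<^esub> q d"
      by blast
    have t_q: "t (q d') d = (if d = d' then q d else 0)" for d d'
      using t_t[of "q d'" d' d, unfolded q(2)] by auto
    have "finite F" "I +>\<^bsub>mpoly_ring\<^esub> p = (\<Oplus>\<^bsub>quot_module J I\<^esub>d\<in>F. I +>\<^bsub>mpoly_ring\<^esub> q d)"
      using w by (simp_all add: F_def p(2) q(3))
    then have dI: "p - (\<Sum>d\<in>F. q d) \<in> I" using q(1) by (simp add: finsum_coset coset_eq_iff[OF mI])
    show "w = (\<lambda>d. I +>\<^bsub>mpoly_ring\<^esub> t p d)"
    proof
      fix d
      have *: "t p d - (if d \<in> F then q d else 0) \<in> I"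
        using t_I[OF dI, of d] \<open>finite F\<close> by (simp add: t_diff t_sum t_q)
      show "w d = I +>\<^bsub>mpoly_ring\<^esub> t p d"
      proof (cases "d \<in> F")
        case True
        then show ?thesis using * q(3) coset_eq_iff[OF mI, of "t p d" "q d"] by simp
      next
        case False
        then show ?thesis using * coset_eq_I_iff[OF mI, of "t p d"] by (simp add: F_def quot_module_simps)
      qed
    qed
  qed
qed

theorem Zn_graded_module_quot: "Zn_graded_module (quot_module J I) (quot_grading J I)"
proof (rule Zn_graded_module.intro, rule module_quot_module, rule Zn_graded_module_axioms.intro)
  interpret abelian_group "quot_module J I" by (rule abelian_group_quot_module)
  show "direct_sum_of (quot_module J I) UNIV (quot_grading J I)" by (rule direct_sum_of_quot_grading)
  fix d
  let ?h = "\<lambda>p d. \<forall>a\<in>Poly_Mapping.keys (p::('n,'k) mpoly). \<forall>i. int (Poly_Mapping.lookup a i) = d i"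
  show "additive_subgroup (quot_grading J I d) (quot_module J I)"
  proof (rule additive_subgroupI, rule add.subgroupI)
    show "quot_grading J I d \<subseteq> carrier (quot_module J I)"
      by (auto simp: quot_grading_def quot_module_simps)
    show "quot_grading J I d \<noteq> {}"
      using J_closed(1) by (auto simp: quot_grading_def intro!: exI[of _ 0])
  next
    fix x assume "x \<in> quot_grading J I d"
    then obtain p where p: "p \<in> J" "?h p d" "x = I +>\<^bsub>mpoly_ring\<^esub> p" by (auto simp: quot_grading_def)
    have "\<ominus>\<^bsub>quot_module J I\<^esub> x = I +>\<^bsub>mpoly_ring\<^esub> (- p)"
      by (rule minus_equality)
        (use p J_closed(4) coset_zero[OF mI] quot_module_simps(3)[of "-p" p]
          in \<open>auto simp: quot_module_simps(1,2)\<close>)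
    then show "\<ominus>\<^bsub>quot_module J I\<^esub> x \<in> quot_grading J I d"
      using p J_closed(4) by (auto simp: quot_grading_def intro!: exI[of _ "-p"])
  next
    fix x y assume "x \<in> quot_grading J I d" "y \<in> quot_grading J I d"
    then obtain p q where p: "p \<in> J" "?h p d" "x = I +>\<^bsub>mpoly_ring\<^esub> p"
      and q: "q \<in> J" "?h q d" "y = I +>\<^bsub>mpoly_ring\<^esub> q" by (auto simp: quot_grading_def)
    have "?h (p + q) d" using p(2) q(2) Poly_Mapping.keys_add[of p q] by blast
    then show "x \<oplus>\<^bsub>quot_module J I\<^esub> y \<in> quot_grading J I d"
      using p q J_closed(2) by (auto simp: quot_grading_def quot_module_simps)
  qed
  fix x a and c :: 'k
  assume "x \<in> quot_grading J I d"
  then obtain p where p: "p \<in> J" "?h p d" "x = I +>\<^bsub>mpoly_ring\<^esub> p" by (auto simp: quot_grading_def)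
  have "?h (Poly_Mapping.single a c * p) (\<lambda>i. d i + int (Poly_Mapping.lookup a i))"
    using p(2) keys_mult[of "Poly_Mapping.single a c" p]
    by (fastforce simp: lookup_add split: if_splits)
  then show "Poly_Mapping.single a c \<odot>\<^bsub>quot_module J I\<^esub> x
      \<in> quot_grading J I (\<lambda>i. d i + int (Poly_Mapping.lookup a i))"
    using p J_closed(3) by (auto simp: quot_grading_def quot_module_simps)
qed

end

end

theory Submission
  imports Defs "HOL-Library.Disjoint_Sets"
begin

text \<open>
  On the level of exponent vectors, a Stanley decomposition of \<open>J/I\<close> is a finite partition of the
  monomials in \<open>J - I\<close> into cones \<open>a + \<nat>\<^sup>Z\<close>. Condition (iii) forces \<open>\<Phi>\<close> to preserve greatest common
  divisors, so the preimage of a cone is empty or again a cone, and a partition for \<open>J2/I2\<close> pulls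
  back to one for \<open>J1/I1\<close> with at most as many parts. A partition for \<open>J2/I2\<close> exists by Dickson's
  lemma; otherwise \<^const>\<open>slength\<close> would be a \<^const>\<open>Least\<close> over the empty set.
\<close>

section \<open>Cones of exponent vectors\<close>

text \<open>Why (iii) controls gcds: \<open>v \<in> cone u Z\<close> says that \<open>u\<close>
  divides \<open>v\<close> with equal exponents outside \<open>Z\<close>. Since \<open>Z\<close> is
  arbitrary, (iii) preserves not only divisibility but also the information in which coordinates a
  divisor attains the exponent of its multiple. In each coordinate, the gcd of \<open>u\<close> and
  \<open>v\<close> attains the exponent of one of them, and its image inherits this coordinate by
  coordinate. Why cones describe the algebra: the classes of the monomials of \<open>J\<close>
  outside \<open>I\<close> are a K-basis of \<open>J/I\<close> with at most one element in each
  degree. Hence a nonzero homogeneous generator is a scalar times the class of a monomial, freeness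
  over \<open>K[Z]\<close> means that no multiple by a monomial of \<open>K[Z]\<close> falls into
  \<open>I\<close>, and a direct sum of such pieces is a disjoint cover of the basis. The field
  enters only through invertible scalars, so the comparison of lengths becomes purely
  combinatorial.\<close>

definition cone :: "('n \<Rightarrow>\<^sub>0 nat) \<Rightarrow> 'n set \<Rightarrow> ('n \<Rightarrow>\<^sub>0 nat) set" where
  "cone a Z = {a + b | b. Poly_Mapping.keys b \<subseteq> Z}"

lemma ex_lookup_eq: "\<exists>u. Poly_Mapping.lookup u = (g :: 'n::finite \<Rightarrow> nat)"
  by (rule exI[of _ "Poly_Mapping.Abs_poly_mapping g"]) simp

text \<open>Membership splits into one condition per coordinate, a lower bound for
  \<open>i \<in> Z\<close> and an equality otherwise. Mixing the coordinates of two members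
  therefore stays inside the cone, which drives the gcd argument.\<close>

lemma cone_iff:
  fixes a :: "'n::finite \<Rightarrow>\<^sub>0 nat"
  shows "b \<in> cone a Z \<longleftrightarrow>
    (\<forall>i. Poly_Mapping.lookup a i \<le> Poly_Mapping.lookup b i \<and>
      (i \<notin> Z \<longrightarrow> Poly_Mapping.lookup a i = Poly_Mapping.lookup b i))"
    (is "_ \<longleftrightarrow> ?R")
proof
  assume "b \<in> cone a Z"
  then show ?R by (fastforce simp: cone_def lookup_add in_keys_iff)
next
  assume R: ?R
  obtain d where d: "Poly_Mapping.lookup d = (\<lambda>i. Poly_Mapping.lookup b i - Poly_Mapping.lookup a i)"
    using ex_lookup_eq by blast
  have "b = a + d" by (rule poly_mapping_eqI) (use R in \<open>simp add: lookup_add d\<close>)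
  moreover have "Poly_Mapping.keys d \<subseteq> Z" using R by (fastforce simp: in_keys_iff d)
  ultimately show "b \<in> cone a Z" unfolding cone_def by blast
qed

lemma cone_self: "a \<in> cone a Z"
  by (auto simp: cone_def intro!: exI[of _ 0])

lemma cone_trans: "b \<in> cone a Z \<Longrightarrow> d \<in> cone b Z \<Longrightarrow> d \<in> cone (a :: 'n::finite \<Rightarrow>\<^sub>0 nat) Z"
  unfolding cone_iff by (metis order_trans)

definition cone_partition :: "('n \<Rightarrow>\<^sub>0 nat) set \<Rightarrow> ('n \<Rightarrow>\<^sub>0 nat) set set \<Rightarrow> bool" where
  "cone_partition A P \<longleftrightarrow> finite P \<and> partition_on A P \<and> (\<forall>C\<in>P. \<exists>a Z. C = cone a Z)"

text \<open>
  The map preserves greatest common divisors, so the preimage of a cone is closed under them and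
  therefore has a least element.
\<close>

lemma vimage_cone:
  fixes \<phi> :: "('n::finite \<Rightarrow>\<^sub>0 nat) \<Rightarrow> ('n \<Rightarrow>\<^sub>0 nat)"
  assumes \<phi>: "\<And>u Z v. v \<in> cone u Z \<longleftrightarrow> \<phi> v \<in> cone (\<phi> u) Z"
    and ne: "\<phi> -` cone w Z \<noteq> {}"
  shows "\<exists>u. \<phi> -` cone w Z = cone u Z"
proof -
  let ?deg = "\<lambda>u::'n \<Rightarrow>\<^sub>0 nat. \<Sum>i\<in>UNIV. Poly_Mapping.lookup u i"
  have gcd_closed: "\<exists>g \<in> \<phi> -` cone w Z.
      Poly_Mapping.lookup g = (\<lambda>i. min (Poly_Mapping.lookup u i) (Poly_Mapping.lookup v i))"
    if uv: "u \<in> \<phi> -` cone w Z" "v \<in> \<phi> -` cone w Z" for u v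
  proof -
    obtain g where g: "Poly_Mapping.lookup g =
        (\<lambda>i. min (Poly_Mapping.lookup u i) (Poly_Mapping.lookup v i))"
      using ex_lookup_eq by blast
    \<comment> \<open>The smallest possible sets of free directions: wherever \<open>g\<close>
      agrees with \<open>u\<close> or \<open>v\<close>, the image of \<open>g\<close> must agree
      with the corresponding image.\<close>
    have "u \<in> cone g {i. Poly_Mapping.lookup g i \<noteq> Poly_Mapping.lookup u i}"
      "v \<in> cone g {i. Poly_Mapping.lookup g i \<noteq> Poly_Mapping.lookup v i}"
      by (simp_all add: cone_iff g)
    then have "\<phi> u \<in> cone (\<phi> g) {i. Poly_Mapping.lookup g i \<noteq> Poly_Mapping.lookup u i}"
      "\<phi> v \<in> cone (\<phi> g) {i. Poly_Mapping.lookup g i \<noteq> Poly_Mapping.lookup v i}"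
      using \<phi> by blast+
    then have eq: "Poly_Mapping.lookup g i = Poly_Mapping.lookup u i \<Longrightarrow>
          Poly_Mapping.lookup (\<phi> g) i = Poly_Mapping.lookup (\<phi> u) i"
        "Poly_Mapping.lookup g i = Poly_Mapping.lookup v i \<Longrightarrow>
          Poly_Mapping.lookup (\<phi> g) i = Poly_Mapping.lookup (\<phi> v) i" for i
      by (simp_all add: cone_iff)
    have "\<phi> g \<in> cone w Z"
      unfolding cone_iff
    proof
      fix i
      have "Poly_Mapping.lookup g i = Poly_Mapping.lookup u i \<or>
          Poly_Mapping.lookup g i = Poly_Mapping.lookup v i" by (simp add: g min_def)
      then have "Poly_Mapping.lookup (\<phi> g) i = Poly_Mapping.lookup (\<phi> u) i \<or>
          Poly_Mapping.lookup (\<phi> g) i = Poly_Mapping.lookup (\<phi> v) i" using eq by blast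
      then show "Poly_Mapping.lookup w i \<le> Poly_Mapping.lookup (\<phi> g) i \<and>
          (i \<notin> Z \<longrightarrow> Poly_Mapping.lookup w i = Poly_Mapping.lookup (\<phi> g) i)"
        using uv by (auto simp: cone_iff)
    qed
    then show ?thesis using g by blast
  qed
  \<comment> \<open>Minimal total degree serves as a substitute for being a least element: the gcd
    with a member not divisible by \<open>u\<close> would have smaller degree.\<close>
  obtain u where u: "u \<in> \<phi> -` cone w Z" "\<And>v. v \<in> \<phi> -` cone w Z \<Longrightarrow> ?deg u \<le> ?deg v"
    using ne ex_has_least_nat[of "\<lambda>u. u \<in> \<phi> -` cone w Z" _ ?deg] by blast
  have u_le: "Poly_Mapping.lookup u i \<le> Poly_Mapping.lookup v i" if v: "v \<in> \<phi> -` cone w Z" for v i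
  proof (rule ccontr)
    assume *: "\<not> ?thesis"
    obtain g where g: "g \<in> \<phi> -` cone w Z"
      "Poly_Mapping.lookup g = (\<lambda>i. min (Poly_Mapping.lookup u i) (Poly_Mapping.lookup v i))"
      using gcd_closed[OF u(1) v] by blast
    have "?deg g < ?deg u"
      by (rule sum_strict_mono_ex1) (use * in \<open>auto simp: g(2) intro!: exI[of _ i]\<close>)
    then show False using u(2)[OF g(1)] by simp
  qed
  have "\<phi> v \<in> cone w Z \<longleftrightarrow> v \<in> cone u Z" for v
  proof
    assume v: "\<phi> v \<in> cone w Z"
    then have "v \<in> cone u UNIV" using u_le[of v] by (simp add: cone_iff)
    then have "\<phi> v \<in> cone (\<phi> u) UNIV" using \<phi> by blast
    \<comment> \<open>Outside \<open>Z\<close> both \<open>\<phi> u\<close> and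
      \<open>\<phi> v\<close> have the coordinates of \<open>w\<close>, so divisibility narrows to
      the cone over \<open>Z\<close>.\<close>
    then have "\<phi> v \<in> cone (\<phi> u) Z" using v u(1) by (simp add: cone_iff)
    then show "v \<in> cone u Z" using \<phi> by blast
  next
    assume "v \<in> cone u Z"
    then show "\<phi> v \<in> cone w Z" using \<phi>[of v u Z] u(1) cone_trans by blast
  qed
  then show ?thesis by blast
qed

text \<open>Taking preimages keeps disjointness and covering. Only nonemptiness can fail, when a
  cone misses the range of \<open>\<phi>\<close>; such parts are discarded, which is where the count
  may drop.\<close>

lemma cone_partition_vimage:
  fixes \<phi> :: "('n::finite \<Rightarrow>\<^sub>0 nat) \<Rightarrow> ('n \<Rightarrow>\<^sub>0 nat)"
  assumes \<phi>: "\<And>u Z v. v \<in> cone u Z \<longleftrightarrow> \<phi> v \<in> cone (\<phi> u) Z"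
    and P: "cone_partition A P"
  shows "\<exists>Q. cone_partition (\<phi> -` A) Q \<and> card Q \<le> card P"
proof (intro exI conjI)
  let ?Q = "(-`) \<phi> ` P - {{}}"
  show "cone_partition (\<phi> -` A) ?Q"
    unfolding cone_partition_def
  proof (intro conjI ballI)
    show "finite ?Q" using P by (simp add: cone_partition_def)
    show "partition_on (\<phi> -` A) ?Q"
      using P partition_on_vimage by (auto simp: cone_partition_def)
  next
    fix C assume "C \<in> ?Q"
    then obtain E where E: "E \<in> P" "C = \<phi> -` E" "C \<noteq> {}" by blast
    moreover obtain w Z where "E = cone w Z" using P E(1) by (auto simp: cone_partition_def)
    ultimately show "\<exists>a Z. C = cone a Z" using vimage_cone[OF \<phi>, of w Z] by blast
  qed
  have "finite P" using P by (simp add: cone_partition_def)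
  then show "card ?Q \<le> card P"
    by (meson Diff_subset card_image_le card_mono finite_imageI order_trans)
qed


section \<open>Existence of cone partitions\<close>

lemma nat_seq_incseq_subseq:
  fixes s :: "nat \<Rightarrow> nat"
  shows "\<exists>r. strict_mono r \<and> incseq (\<lambda>k. s (r k))"
proof -
  obtain f :: "nat \<Rightarrow> nat" where f: "strict_mono f" "monoseq (\<lambda>k. s (f k))"
    using seq_monosub[of s] by blast
  show ?thesis
  proof (cases "incseq (\<lambda>k. s (f k))")
    case False
    then have dec: "decseq (\<lambda>k. s (f k))" using f(2) by (simp add: monoseq_iff)
    \<comment> \<open>A decreasing sequence of naturals is constant from the index where it attains
      its least value, so the tail from \<open>k\<close> on is increasing too.\<close>
    obtain k where k: "\<And>l. s (f k) \<le> s (f l)"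
      using ex_has_least_nat[of "\<lambda>_. True" _ "\<lambda>k. s (f k)"] by blast
    have "s (f (k + l)) = s (f k)" for l
      using decseqD[OF dec, of k "k + l"] k[of "k + l"] by simp
    then have "incseq (\<lambda>l. s (f (k + l)))" by (simp add: incseq_def)
    moreover have "strict_mono (\<lambda>l. f (k + l))"
      using f(1) by (simp add: strict_mono_def)
    ultimately show ?thesis by (intro exI[of _ "\<lambda>l. f (k + l)"]) simp
  qed (use f in blast)
qed

text \<open>Coordinates are treated one at a time: passing to a further subsequence keeps the
  coordinates already handled increasing.\<close>

lemma dickson_subseq:
  fixes s :: "nat \<Rightarrow> 'n \<Rightarrow> nat"
  assumes "finite T"
  shows "\<exists>r. strict_mono r \<and> (\<forall>i\<in>T. incseq (\<lambda>k. s (r k) i))"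
  using assms
proof (induction T rule: finite_induct)
  case empty
  then show ?case by (intro exI[of _ "\<lambda>k. k"]) (simp add: strict_mono_def)
next
  case (insert j T)
  then obtain r where r: "strict_mono r" "\<And>i. i \<in> T \<Longrightarrow> incseq (\<lambda>k. s (r k) i)" by blast
  obtain t where t: "strict_mono t" "incseq (\<lambda>k. s (r (t k)) j)"
    using nat_seq_incseq_subseq[of "\<lambda>k. s (r k) j"] by blast
  have "incseq (\<lambda>k. s (r (t k)) i)" if "i \<in> T" for i
    using r(2)[OF that] t(1) by (simp add: incseq_def strict_mono_less_eq)
  moreover have "strict_mono (\<lambda>k. r (t k))" using r(1) t(1) by (simp add: strict_mono_def)
  ultimately show ?case using t(2) by (intro exI[of _ "\<lambda>k. r (t k)"]) auto
qed

section \<open>Upsets and truncation of exponents\<close>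

definition upset :: "('n \<Rightarrow>\<^sub>0 nat) set \<Rightarrow> bool" where
  "upset U \<longleftrightarrow> (\<forall>u\<in>U. cone u UNIV \<subseteq> U)"

definition truncate :: "nat \<Rightarrow> ('n::finite \<Rightarrow>\<^sub>0 nat) \<Rightarrow> ('n \<Rightarrow>\<^sub>0 nat)" where
  "truncate N u = Poly_Mapping.Abs_poly_mapping (\<lambda>i. min (Poly_Mapping.lookup u i) N)"

lemma lookup_truncate [simp]:
  "Poly_Mapping.lookup (truncate N u) i = min (Poly_Mapping.lookup u i) N"
  by (simp add: truncate_def)

text \<open>\<open>N\<close> plays the role of a bound for the exponents of the finitely many
  minimal generators of a monomial ideal; larger exponents do not affect membership. Allowing every
  larger \<open>M\<close> lets two upsets share one bound.\<close>

lemma upset_truncate: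
  fixes U :: "('n::finite \<Rightarrow>\<^sub>0 nat) set"
  assumes U: "upset U"
  shows "\<exists>N. \<forall>M\<ge>N. \<forall>u. truncate M u \<in> U \<longleftrightarrow> u \<in> U"
proof -
  have up: "v \<in> U" if "u \<in> U" "\<And>i. Poly_Mapping.lookup u i \<le> Poly_Mapping.lookup v i" for u v
  proof -
    have "v \<in> cone u UNIV" using that(2) by (simp add: cone_iff)
    then show ?thesis using U that(1) by (auto simp: upset_def)
  qed
  have "\<exists>N. \<forall>u\<in>U. truncate N u \<in> U"
  proof (rule ccontr)
    assume "\<not> ?thesis"
    then obtain s where s: "\<And>N. s N \<in> U" "\<And>N. truncate N (s N) \<notin> U" by metis
    obtain r where r: "strict_mono r" "\<And>i. incseq (\<lambda>k. Poly_Mapping.lookup (s (r k)) i)"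
      using dickson_subseq[of UNIV "\<lambda>N. Poly_Mapping.lookup (s N)"] by auto
    \<comment> \<open>Chosen to exceed every exponent of \<open>s (r 0)\<close>. Truncation at
      \<open>r k \<ge> k\<close> then leaves \<open>s (r k)\<close> above
      \<open>s (r 0) \<in> U\<close>, against the choice of \<open>s\<close>.\<close>
    define k where "k = (\<Sum>i\<in>UNIV. Poly_Mapping.lookup (s (r 0)) i)"
    have "Poly_Mapping.lookup (s (r 0)) i \<le> Poly_Mapping.lookup (truncate (r k) (s (r k))) i" for i
    proof -
      have "Poly_Mapping.lookup (s (r 0)) i \<le> k"
        unfolding k_def by (rule member_le_sum) auto
      also have "k \<le> r k" using r(1) by (rule strict_mono_imp_increasing)
      finally show ?thesis using incseqD[OF r(2), of 0 k i] by simp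
    qed
    then show False using up s by blast
  qed
  then obtain N where N: "\<And>u. u \<in> U \<Longrightarrow> truncate N u \<in> U" by blast
  have "truncate M u \<in> U \<longleftrightarrow> u \<in> U" if "M \<ge> N" for M u
  proof
    assume "truncate M u \<in> U"
    then show "u \<in> U" by (rule up) simp
  next
    assume "u \<in> U"
    then show "truncate M u \<in> U" by (rule up[OF N]) (use that in simp)
  qed
  then show ?thesis by blast
qed

text \<open>
  The fibres of a truncation are cones, and for a large bound both upsets are unions of fibres.
\<close>

lemma ex_cone_partition:
  fixes U V :: "('n::finite \<Rightarrow>\<^sub>0 nat) set"
  assumes "upset U" "upset V"
  shows "\<exists>P. cone_partition (U - V) P"
proof -
  obtain N1 where N1: "\<And>M u. M \<ge> N1 \<Longrightarrow> truncate M u \<in> U \<longleftrightarrow> u \<in> U"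
    using upset_truncate[OF assms(1)] by blast
  obtain N2 where N2: "\<And>M u. M \<ge> N2 \<Longrightarrow> truncate M u \<in> V \<longleftrightarrow> u \<in> V"
    using upset_truncate[OF assms(2)] by blast
  define N where "N = max N1 N2"
  have N: "truncate N u \<in> U \<longleftrightarrow> u \<in> U" "truncate N u \<in> V \<longleftrightarrow> u \<in> V" for u
    using N1[of N] N2[of N] by (simp_all add: N_def)
  define fibre where "fibre u = {v. truncate N v = truncate N u}" for u :: "'n \<Rightarrow>\<^sub>0 nat"
  have truncate_idem: "truncate N (truncate N u) = truncate N u" for u :: "'n \<Rightarrow>\<^sub>0 nat"
    by (rule poly_mapping_eqI) simp
  have trunc_eq: "truncate N v = truncate N u \<longleftrightarrow>
      (\<forall>i. min (Poly_Mapping.lookup v i) N = min (Poly_Mapping.lookup u i) N)"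
      for u v :: "'n \<Rightarrow>\<^sub>0 nat"
    by (metis lookup_truncate poly_mapping_eqI)
  \<comment> \<open>A coordinate below \<open>N\<close> can be read off the truncation; one that has
    reached \<open>N\<close> may take any value from \<open>N\<close> on, so it is a free
    direction.\<close>
  have fibre_cone: "fibre u = cone (truncate N u) {i. Poly_Mapping.lookup u i \<ge> N}" for u
  proof -
    have "min (Poly_Mapping.lookup v i) N = min (Poly_Mapping.lookup u i) N \<longleftrightarrow>
        min (Poly_Mapping.lookup u i) N \<le> Poly_Mapping.lookup v i \<and>
        (\<not> N \<le> Poly_Mapping.lookup u i \<longrightarrow>
          min (Poly_Mapping.lookup u i) N = Poly_Mapping.lookup v i)" for v :: "'n \<Rightarrow>\<^sub>0 nat" and i
      by linarith
    then show ?thesis unfolding fibre_def trunc_eq by (auto simp: cone_iff)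
  qed
  have "finite (range (truncate N :: ('n \<Rightarrow>\<^sub>0 nat) \<Rightarrow> _))"
  proof (rule finite_imageD)
    have "Poly_Mapping.lookup ` range (truncate N :: ('n \<Rightarrow>\<^sub>0 nat) \<Rightarrow> _)
        \<subseteq> (\<Pi>\<^sub>E i\<in>UNIV. {..N})" by auto
    then show "finite (Poly_Mapping.lookup ` range (truncate N :: ('n \<Rightarrow>\<^sub>0 nat) \<Rightarrow> _))"
      by (rule finite_subset) (simp add: finite_PiE)
    show "inj_on Poly_Mapping.lookup (range (truncate N :: ('n \<Rightarrow>\<^sub>0 nat) \<Rightarrow> _))"
      by (auto intro!: inj_onI poly_mapping_eqI)
  qed
  moreover have "fibre ` (U - V) \<subseteq> fibre ` range (truncate N)"
  proof
    fix C assume "C \<in> fibre ` (U - V)"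
    then obtain u where "C = fibre u" by blast
    then have "C = fibre (truncate N u)" by (simp add: fibre_def truncate_idem)
    then show "C \<in> fibre ` range (truncate N)" by blast
  qed
  ultimately have "finite (fibre ` (U - V))" by (meson finite_imageI finite_subset)
  moreover have "partition_on (U - V) (fibre ` (U - V))"
  proof (rule partition_onI)
    have "fibre u \<subseteq> U - V" if "u \<in> U - V" for u
    proof
      fix v assume "v \<in> fibre u"
      then have "truncate N v = truncate N u" by (simp add: fibre_def)
      then show "v \<in> U - V" using N[of u] N[of v] that by simp
    qed
    moreover have "u \<in> fibre u" for u by (simp add: fibre_def)
    ultimately show "\<Union> (fibre ` (U - V)) = U - V" "{} \<notin> fibre ` (U - V)" by blast+
    show "disjnt p q" if "p \<in> fibre ` (U - V)" "q \<in> fibre ` (U - V)" "p \<noteq> q" for p q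
      using that by (auto simp: fibre_def disjnt_def)
  qed
  ultimately show ?thesis unfolding cone_partition_def using fibre_cone by blast
qed


section \<open>Polynomials and monomial ideals\<close>

lemma poly_eq_sum_single:
  fixes p :: "('n, 'k::field) mpoly"
  shows "p = (\<Sum>a\<in>Poly_Mapping.keys p. Poly_Mapping.single a (Poly_Mapping.lookup p a))"
  by (rule poly_mapping_eqI) (auto simp: lookup_sum lookup_single when_def in_keys_iff sum.delta')

lemma lookup_times_single:
  fixes f :: "('n, 'k::field) mpoly"
  shows "Poly_Mapping.lookup (f * Poly_Mapping.single a c) (a + b) = Poly_Mapping.lookup f b * c"
proof -
  have "f * Poly_Mapping.single a c =
      (\<Sum>b\<in>Poly_Mapping.keys f. Poly_Mapping.single (b + a) (Poly_Mapping.lookup f b * c))"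
    by (subst poly_eq_sum_single[of f]) (simp add: sum_distrib_right mult_single)
  then show ?thesis
    by (auto simp: lookup_sum lookup_single when_def add.commute[of a] in_keys_iff sum.delta')
qed

text \<open>Multiplication by a monomial shifts exponents by \<open>a\<close>, and the nonzero
  scalar can be divided out. This is the bridge from the spaces \<open>uK[Z]\<close> to
  cones.\<close>

lemma poly_in_times_single:
  fixes c :: "'k::field" and a :: "'n::finite \<Rightarrow>\<^sub>0 nat"
  assumes "c \<noteq> 0"
  shows "(\<lambda>f. f * Poly_Mapping.single a c) ` poly_in Z = {q. Poly_Mapping.keys q \<subseteq> cone a Z}"
proof (intro equalityI subsetI)
  fix q assume "q \<in> (\<lambda>f. f * Poly_Mapping.single a c) ` poly_in Z"
  then obtain f where f: "f \<in> poly_in Z" "q = f * Poly_Mapping.single a c" by blast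
  then show "q \<in> {q. Poly_Mapping.keys q \<subseteq> cone a Z}"
    using keys_mult[of f "Poly_Mapping.single a c"] assms
    by (fastforce simp: poly_in_def cone_def add.commute)
next
  fix q :: "('n, 'k) mpoly" assume "q \<in> {q. Poly_Mapping.keys q \<subseteq> cone a Z}"
  then have q: "Poly_Mapping.keys q \<subseteq> cone a Z" by simp
  then have sub: "Poly_Mapping.keys (b - a) \<subseteq> Z \<and> b - a + a = b" if b: "b \<in> Poly_Mapping.keys q" for b
  proof -
    obtain d where "b = a + d" "Poly_Mapping.keys d \<subseteq> Z" using q b by (auto simp: cone_def)
    then show ?thesis by (simp add: add.commute)
  qed
  \<comment> \<open>Division of \<open>q\<close> by its monomial factor, term by term. The
    difference \<open>b - a\<close> is truncated subtraction, which is exact because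
    \<open>a\<close> divides every monomial of \<open>q\<close>.\<close>
  define f where
    "f = (\<Sum>b\<in>Poly_Mapping.keys q. Poly_Mapping.single (b - a) (Poly_Mapping.lookup q b / c))"
  have "f * Poly_Mapping.single a c =
      (\<Sum>b\<in>Poly_Mapping.keys q. Poly_Mapping.single b (Poly_Mapping.lookup q b))"
    unfolding f_def sum_distrib_right by (rule sum.cong) (use sub assms in \<open>auto simp: mult_single\<close>)
  then have "q = f * Poly_Mapping.single a c" using poly_eq_sum_single[of q] by simp
  moreover have "Poly_Mapping.keys f \<subseteq>
      (\<Union>b\<in>Poly_Mapping.keys q. Poly_Mapping.keys (Poly_Mapping.single (b - a) (Poly_Mapping.lookup q b / c)))"
    unfolding f_def by (rule keys_sum)
  then have "f \<in> poly_in Z" using sub by (fastforce simp: poly_in_def split: if_splits)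
  ultimately show "q \<in> (\<lambda>f. f * Poly_Mapping.single a c) ` poly_in Z" by blast
qed

lemma single_in_Stanley_space_iff:
  fixes a b :: "'n::finite \<Rightarrow>\<^sub>0 nat"
  shows "Poly_Mapping.single b (1::'k::field) \<in> Stanley_space (Poly_Mapping.single a 1) Z \<longleftrightarrow>
    b \<in> cone a Z"
proof -
  have "Stanley_space (Poly_Mapping.single a (1::'k)) Z = {q. Poly_Mapping.keys q \<subseteq> cone a Z}"
    using poly_in_times_single[of "1::'k" a Z]
    by (simp add: Stanley_space_def image_def mult.commute Bex_def conj_commute Setcompr_eq_image)
  then show ?thesis by simp
qed

definition exps :: "('n::finite, 'k::field) mpoly set \<Rightarrow> ('n \<Rightarrow>\<^sub>0 nat) set" where
  "exps I = {a. Poly_Mapping.single a 1 \<in> I}"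

lemma single_mem_monomial_ideal_iff:
  fixes I :: "('n::finite, 'k::field) mpoly set"
  assumes I: "monomial_ideal I" and "c \<noteq> 0"
  shows "Poly_Mapping.single a c \<in> I \<longleftrightarrow> a \<in> exps I"
  using monomial_ideal_closed(3)[OF I, of "Poly_Mapping.single a c" "Poly_Mapping.single 0 (inverse c)"]
    monomial_ideal_closed(3)[OF I, of "Poly_Mapping.single a 1" "Poly_Mapping.single 0 c"] assms(2)
  by (auto simp: exps_def mult_single)

text \<open>A monomial ideal contains each term of its elements, so it is the K-span of its
  monomials and is determined by their exponents.\<close>

lemma mem_monomial_ideal_iff:
  fixes I :: "('n::finite, 'k::field) mpoly set"
  assumes I: "monomial_ideal I"
  shows "p \<in> I \<longleftrightarrow> Poly_Mapping.keys p \<subseteq> exps I"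
proof
  assume p: "p \<in> I"
  show "Poly_Mapping.keys p \<subseteq> exps I"
  proof
    fix a assume "a \<in> Poly_Mapping.keys p"
    then show "a \<in> exps I"
      using monomial_ideal_term[OF I p, of a]
        single_mem_monomial_ideal_iff[OF I, of "Poly_Mapping.lookup p a" a]
      by (simp add: in_keys_iff)
  qed
next
  assume p: "Poly_Mapping.keys p \<subseteq> exps I"
  show "p \<in> I"
    by (subst poly_eq_sum_single, rule monomial_ideal_sum[OF I])
      (use p in \<open>auto simp: single_mem_monomial_ideal_iff[OF I] in_keys_iff\<close>)
qed

lemma upset_exps:
  assumes "monomial_ideal (I :: ('n::finite, 'k::field) mpoly set)"
  shows "upset (exps I)"
  unfolding upset_def
proof (intro ballI subsetI)
  fix u v assume "u \<in> exps I" "v \<in> cone u UNIV"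
  then obtain b where "v = b + u" "Poly_Mapping.single u 1 \<in> I"
    by (auto simp: cone_def exps_def add.commute)
  then show "v \<in> exps I"
    using monomial_ideal_closed(3)[OF assms, of "Poly_Mapping.single u 1" "Poly_Mapping.single b 1"]
    by (simp add: exps_def mult_single)
qed


lemma direct_sum_of_cong:
  assumes "\<And>i. i \<in> A \<Longrightarrow> V i = W i"
  shows "direct_sum_of M A V \<longleftrightarrow> direct_sum_of M A W"
proof -
  have "(\<Pi>\<^sub>E i\<in>A. V i) = (\<Pi>\<^sub>E i\<in>A. W i)" by (rule PiE_cong) (rule assms)
  then show ?thesis unfolding direct_sum_of_def using assms by simp
qed


section \<open>Stanley decompositions of quotients of monomial ideals\<close>

context
  fixes I J :: "('n::finite, 'k::field) mpoly set"
  assumes mI: "monomial_ideal I" and mJ: "monomial_ideal J" and IJ: "I \<subseteq> J"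
begin

text \<open>The image in \<open>J/I\<close> of the K-span of the monomials with exponents in
  \<open>C\<close>. Allowing \<open>C = {}\<close> gives the zero space, so zero summands need no
  separate treatment.\<close>

definition coset_span :: "('n \<Rightarrow>\<^sub>0 nat) set \<Rightarrow> ('n, 'k) mpoly set set" where
  "coset_span C = {I +>\<^bsub>mpoly_ring\<^esub> q | q. Poly_Mapping.keys q \<subseteq> C}"

lemma keys_subset_imp_mem:
  assumes "Poly_Mapping.keys q \<subseteq> exps J - exps I"
  shows "q \<in> J"
  using assms mem_monomial_ideal_iff[OF mJ] by blast

text \<open>Linear independence of the basis of \<open>J/I\<close>: a difference of two such
  polynomials that lies in \<open>I\<close> has no monomial left.\<close>

lemma coset_eq_imp_eq:
  assumes "Poly_Mapping.keys p \<subseteq> exps J - exps I" "Poly_Mapping.keys q \<subseteq> exps J - exps I"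
    and "I +>\<^bsub>mpoly_ring\<^esub> p = I +>\<^bsub>mpoly_ring\<^esub> q"
  shows "p = q"
proof -
  have "Poly_Mapping.keys (p - q) \<subseteq> exps I"
    using assms(3) by (simp add: coset_eq_iff[OF mI] mem_monomial_ideal_iff[OF mI])
  then have "Poly_Mapping.keys (p - q) = {}" using assms(1,2) keys_diff[of p q] by blast
  then show "p = q" by simp
qed

text \<open>Comparison of coefficients in the monomial basis of \<open>J/I\<close>: terms in
  \<open>I\<close> are invisible in the quotient, and elements of \<open>J\<close> have no terms
  outside \<open>J\<close>.\<close>

lemma coset_eq_finsum_iff:
  assumes T: "finite T" and q: "\<And>i. i \<in> T \<Longrightarrow> Poly_Mapping.keys (q i) \<subseteq> exps J - exps I"
    and p: "p \<in> J"
  defines "w \<equiv> \<lambda>i\<in>T. I +>\<^bsub>mpoly_ring\<^esub> q i"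
  shows "I +>\<^bsub>mpoly_ring\<^esub> p = (\<Oplus>\<^bsub>quot_module J I\<^esub>i\<in>{i\<in>T. w i \<noteq> \<zero>\<^bsub>quot_module J I\<^esub>}. w i) \<longleftrightarrow>
    (\<forall>u\<in>exps J - exps I. Poly_Mapping.lookup p u = (\<Sum>i\<in>T. Poly_Mapping.lookup (q i) u))"
proof -
  interpret abelian_group "quot_module J I" by (rule abelian_group_quot_module[OF mI mJ IJ])
  let ?F = "{i\<in>T. w i \<noteq> \<zero>\<^bsub>quot_module J I\<^esub>}"
  have qJ: "q i \<in> J" if "i \<in> T" for i using keys_subset_imp_mem[OF q[OF that]] .
  \<comment> \<open>A vanishing class forces the representative itself to be zero, so the sum over
    the support equals the sum over all of \<open>T\<close>.\<close>
  have q0: "q i = 0" if "i \<in> T - ?F" for i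
  proof -
    have "I +>\<^bsub>mpoly_ring\<^esub> q i = I +>\<^bsub>mpoly_ring\<^esub> 0"
      using that by (simp add: w_def quot_module_simps(2)[OF mI mJ IJ] coset_zero[OF mI])
    then show ?thesis using coset_eq_imp_eq[of "q i" 0] q that by simp
  qed
  have "(\<Oplus>\<^bsub>quot_module J I\<^esub>i\<in>?F. w i) = (\<Oplus>\<^bsub>quot_module J I\<^esub>i\<in>?F. I +>\<^bsub>mpoly_ring\<^esub> q i)"
    by (rule finsum_cong') (use qJ in \<open>auto simp: w_def quot_module_simps[OF mI mJ IJ]\<close>)
  also have "\<dots> = I +>\<^bsub>mpoly_ring\<^esub> (\<Sum>i\<in>?F. q i)"
    by (rule finsum_coset[OF mI mJ IJ]) (use T qJ in auto)
  also have "(\<Sum>i\<in>?F. q i) = (\<Sum>i\<in>T. q i)"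
    by (rule sum.mono_neutral_left) (use T q0 in auto)
  finally have *: "(\<Oplus>\<^bsub>quot_module J I\<^esub>i\<in>?F. w i) = I +>\<^bsub>mpoly_ring\<^esub> (\<Sum>i\<in>T. q i)" .
  have outside: "Poly_Mapping.lookup (p - (\<Sum>i\<in>T. q i)) u = 0" if "u \<notin> exps J" for u
  proof -
    have "p - (\<Sum>i\<in>T. q i) \<in> J"
      using p qJ monomial_ideal_sum[OF mJ] monomial_ideal_closed(5)[OF mJ] by blast
    then show ?thesis using that mem_monomial_ideal_iff[OF mJ] by (auto simp: in_keys_iff)
  qed
  have "I +>\<^bsub>mpoly_ring\<^esub> p = I +>\<^bsub>mpoly_ring\<^esub> (\<Sum>i\<in>T. q i) \<longleftrightarrow>
      (\<forall>u. u \<notin> exps I \<longrightarrow> Poly_Mapping.lookup (p - (\<Sum>i\<in>T. q i)) u = 0)"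
    by (auto simp: coset_eq_iff[OF mI] mem_monomial_ideal_iff[OF mI] in_keys_iff)
  also have "\<dots> \<longleftrightarrow> (\<forall>u\<in>exps J - exps I. Poly_Mapping.lookup (p - (\<Sum>i\<in>T. q i)) u = 0)"
    using outside by auto
  finally show ?thesis unfolding * by (simp add: lookup_minus lookup_sum)
qed

text \<open>The spaces are spanned by subsets of one K-basis of \<open>J/I\<close>. Spans of this
  kind decompose the whole space exactly when the subsets decompose the basis.\<close>

lemma direct_sum_of_coset_span_iff:
  assumes T: "finite T" and C: "\<And>i. i \<in> T \<Longrightarrow> C i \<subseteq> exps J - exps I"
  shows "direct_sum_of (quot_module J I) T (\<lambda>i. coset_span (C i)) \<longleftrightarrow>
    disjoint_family_on C T \<and> (\<Union>i\<in>T. C i) = exps J - exps I"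
proof
  let ?M = "quot_module J I"
  let ?sum = "\<lambda>w. \<Oplus>\<^bsub>?M\<^esub>i\<in>{i\<in>T. w i \<noteq> \<zero>\<^bsub>?M\<^esub>}. w i"
  {
    assume ds: "direct_sum_of ?M T (\<lambda>i. coset_span (C i))"
    have ex1: "\<exists>!w. w \<in> (\<Pi>\<^sub>E i\<in>T. coset_span (C i)) \<and> I +>\<^bsub>mpoly_ring\<^esub> p = ?sum w"
      if "p \<in> J" for p
    proof -
      have "I +>\<^bsub>mpoly_ring\<^esub> p \<in> carrier ?M" using that by (auto simp: quot_module_simps[OF mI mJ IJ])
      then show ?thesis using ds T by (simp add: direct_sum_of_def)
    qed
    have cover: "u \<in> (\<Union>i\<in>T. C i)" if u: "u \<in> exps J - exps I" for u
    proof -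
      let ?p = "Poly_Mapping.single u (1::'k)"
      have pJ: "?p \<in> J" using u by (simp add: exps_def)
      obtain w where w: "w \<in> (\<Pi>\<^sub>E i\<in>T. coset_span (C i))" "I +>\<^bsub>mpoly_ring\<^esub> ?p = ?sum w"
        using ex1[OF pJ] by blast
      then have "\<forall>i\<in>T. \<exists>q. Poly_Mapping.keys q \<subseteq> C i \<and> w i = I +>\<^bsub>mpoly_ring\<^esub> q"
        unfolding coset_span_def PiE_iff by blast
      then obtain q where
        q: "\<And>i. i \<in> T \<Longrightarrow> Poly_Mapping.keys (q i) \<subseteq> C i" "\<And>i. i \<in> T \<Longrightarrow> w i = I +>\<^bsub>mpoly_ring\<^esub> q i"
        by metis
      have "w = (\<lambda>i\<in>T. I +>\<^bsub>mpoly_ring\<^esub> q i)" by (rule ext) (use w(1) q(2) in \<open>auto simp: PiE_iff extensional_def\<close>)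
      moreover have "Poly_Mapping.keys (q i) \<subseteq> exps J - exps I" if "i \<in> T" for i
        using q(1)[OF that] C[OF that] by blast
      ultimately have "Poly_Mapping.lookup ?p u = (\<Sum>i\<in>T. Poly_Mapping.lookup (q i) u)"
        using coset_eq_finsum_iff[THEN iffD1, OF T _ pJ, of q] w(2) u by blast
      then have "(\<Sum>i\<in>T. Poly_Mapping.lookup (q i) u) = 1" by simp
      then obtain i where "i \<in> T" "Poly_Mapping.lookup (q i) u \<noteq> 0"
        by (metis sum.neutral zero_neq_one)
      then show ?thesis using q(1)[of i] unfolding in_keys_iff[symmetric] by blast
    qed
    have "C i \<inter> C j = {}" if ij: "i \<in> T" "j \<in> T" "i \<noteq> j" for i j
    proof (rule ccontr)
      assume "C i \<inter> C j \<noteq> {}"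
      then obtain u where u: "u \<in> C i" "u \<in> C j" by blast
      let ?p = "Poly_Mapping.single u (1::'k)"
      have uA: "u \<in> exps J - exps I" using u C ij by blast
      have pJ: "?p \<in> J" using uA by (simp add: exps_def)
      \<comment> \<open>A common monomial can be placed in the summand \<open>i\<close> or in the
        summand \<open>j\<close>: two decompositions of the same class, against uniqueness.\<close>
      define w where "w k = (\<lambda>l\<in>T. I +>\<^bsub>mpoly_ring\<^esub> (if l = k then ?p else 0))" for k
      have "w k \<in> (\<Pi>\<^sub>E i\<in>T. coset_span (C i)) \<and> I +>\<^bsub>mpoly_ring\<^esub> ?p = ?sum (w k)"
        if k: "k \<in> T" "u \<in> C k" for k
      proof
        show "w k \<in> (\<Pi>\<^sub>E i\<in>T. coset_span (C i))"
        proof (rule PiE_I)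
          fix l assume l: "l \<in> T"
          show "w k l \<in> coset_span (C l)"
            unfolding coset_span_def mem_Collect_eq
            by (rule exI[of _ "if l = k then ?p else 0"]) (use k l in \<open>auto simp: w_def\<close>)
        qed (simp add: w_def)
        show "I +>\<^bsub>mpoly_ring\<^esub> ?p = ?sum (w k)"
          unfolding w_def
        proof (rule coset_eq_finsum_iff[THEN iffD2, OF T _ pJ], goal_cases)
          case (1 l)
          then show ?case using uA by simp
        next
          case 2
          have "(\<Sum>l\<in>T. Poly_Mapping.lookup (if l = k then ?p else 0) v) =
              (\<Sum>l\<in>T. if l = k then Poly_Mapping.lookup ?p v else 0)" for v
            by (rule sum.cong) auto
          then show ?case using T k by simp
        qed
      qed
      from this[OF ij(1) u(1)] this[OF ij(2) u(2)] have "w i = w j" using ex1[OF pJ] by blast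
      then have "w i i = w j i" by simp
      then have "?p = 0"
        using coset_eq_imp_eq[of ?p 0] ij uA by (simp add: w_def)
      then show False by (metis lookup_single_eq lookup_zero zero_neq_one)
    qed
    then have "disjoint_family_on C T" by (auto simp: disjoint_family_on_def)
    then show "disjoint_family_on C T \<and> (\<Union>i\<in>T. C i) = exps J - exps I"
      using cover C by blast
  }
  assume dc: "disjoint_family_on C T \<and> (\<Union>i\<in>T. C i) = exps J - exps I"
  have single_index: "(\<Sum>k\<in>T. Poly_Mapping.lookup (q k) u) = Poly_Mapping.lookup (q i) u"
    if q: "\<And>k. k \<in> T \<Longrightarrow> Poly_Mapping.keys (q k) \<subseteq> C k" and i: "i \<in> T" "u \<in> C i"
    for q :: "_ \<Rightarrow> ('n, 'k) mpoly" and i u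
  proof -
    have "Poly_Mapping.lookup (q k) u = 0" if k: "k \<in> T - {i}" for k
    proof -
      have "C k \<inter> C i = {}" using dc k i by (auto simp: disjoint_family_on_def)
      then show ?thesis using q[of k] k i by (auto simp: in_keys_iff)
    qed
    then have "(\<Sum>k\<in>T. Poly_Mapping.lookup (q k) u) = (\<Sum>k\<in>{i}. Poly_Mapping.lookup (q k) u)"
      by (intro sum.mono_neutral_right) (use T i in auto)
    then show ?thesis by simp
  qed
  show "direct_sum_of ?M T (\<lambda>i. coset_span (C i))"
    unfolding direct_sum_of_def
  proof (intro conjI ballI)
    fix i assume "i \<in> T"
    then show "coset_span (C i) \<subseteq> carrier ?M"
      using C[of i] keys_subset_imp_mem by (fastforce simp: coset_span_def quot_module_simps[OF mI mJ IJ])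
  next
    fix x assume "x \<in> carrier ?M"
    then obtain p where p: "p \<in> J" "x = I +>\<^bsub>mpoly_ring\<^esub> p"
      by (auto simp: quot_module_simps[OF mI mJ IJ])
    \<comment> \<open>The component at \<open>i\<close> is the part of \<open>p\<close> with
      exponents in \<open>C i\<close>. Terms of \<open>p\<close> in \<open>I\<close> get lost, which
      does not change the class.\<close>
    have "\<exists>r. \<forall>u. Poly_Mapping.lookup r u = (if u \<in> C i then Poly_Mapping.lookup p u else 0)" for i
    proof (intro exI allI)
      show "Poly_Mapping.lookup (\<Sum>a | a \<in> Poly_Mapping.keys p \<and> a \<in> C i.
          Poly_Mapping.single a (Poly_Mapping.lookup p a)) u =
          (if u \<in> C i then Poly_Mapping.lookup p u else 0)" for u
        by (auto simp: lookup_sum lookup_single when_def in_keys_iff sum.delta')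
    qed
    then obtain r where
      r: "\<And>i u. Poly_Mapping.lookup (r i) u = (if u \<in> C i then Poly_Mapping.lookup p u else 0)"
      by metis
    have r_keys: "Poly_Mapping.keys (r i) \<subseteq> C i" for i by (auto simp: in_keys_iff r split: if_splits)
    show "\<exists>!w. w \<in> (\<Pi>\<^sub>E i\<in>T. coset_span (C i)) \<and> finite {i \<in> T. w i \<noteq> \<zero>\<^bsub>?M\<^esub>} \<and> x = ?sum w"
    proof (rule ex1I[of _ "\<lambda>i\<in>T. I +>\<^bsub>mpoly_ring\<^esub> r i"], intro conjI)
      show "(\<lambda>i\<in>T. I +>\<^bsub>mpoly_ring\<^esub> r i) \<in> (\<Pi>\<^sub>E i\<in>T. coset_span (C i))"
        using r_keys by (fastforce simp: coset_span_def)
      show "finite {i \<in> T. (\<lambda>i\<in>T. I +>\<^bsub>mpoly_ring\<^esub> r i) i \<noteq> \<zero>\<^bsub>?M\<^esub>}" using T by simp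
      show "x = ?sum (\<lambda>i\<in>T. I +>\<^bsub>mpoly_ring\<^esub> r i)"
        unfolding p(2)
      proof (rule coset_eq_finsum_iff[THEN iffD2, OF T _ p(1)])
        show "Poly_Mapping.keys (r i) \<subseteq> exps J - exps I" if "i \<in> T" for i
          using r_keys C[OF that] by blast
        show "\<forall>u\<in>exps J - exps I. Poly_Mapping.lookup p u = (\<Sum>i\<in>T. Poly_Mapping.lookup (r i) u)"
        proof
          fix u assume "u \<in> exps J - exps I"
          then obtain i where "i \<in> T" "u \<in> C i" using dc by blast
          then show "Poly_Mapping.lookup p u = (\<Sum>i\<in>T. Poly_Mapping.lookup (r i) u)"
            using single_index[of r i u] r_keys r by simp
        qed
      qed
    next
      fix w
      assume w: "w \<in> (\<Pi>\<^sub>E i\<in>T. coset_span (C i)) \<and> finite {i \<in> T. w i \<noteq> \<zero>\<^bsub>?M\<^esub>} \<and> x = ?sum w"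
      then have "\<forall>i\<in>T. \<exists>q. Poly_Mapping.keys q \<subseteq> C i \<and> w i = I +>\<^bsub>mpoly_ring\<^esub> q"
        unfolding coset_span_def PiE_iff by blast
      then obtain q where
        q: "\<And>i. i \<in> T \<Longrightarrow> Poly_Mapping.keys (q i) \<subseteq> C i" "\<And>i. i \<in> T \<Longrightarrow> w i = I +>\<^bsub>mpoly_ring\<^esub> q i"
        by metis
      have w_eq: "w = (\<lambda>i\<in>T. I +>\<^bsub>mpoly_ring\<^esub> q i)" by (rule ext) (use w q(2) in \<open>auto simp: PiE_iff extensional_def\<close>)
      have "Poly_Mapping.keys (q i) \<subseteq> exps J - exps I" if "i \<in> T" for i
        using q(1)[OF that] C[OF that] by blast
      then have *: "Poly_Mapping.lookup p u = (\<Sum>i\<in>T. Poly_Mapping.lookup (q i) u)"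
        if "u \<in> exps J - exps I" for u
        using w coset_eq_finsum_iff[OF T, of q p] p that unfolding w_eq by auto
      have "q i = r i" if i: "i \<in> T" for i
      proof (rule poly_mapping_eqI)
        fix u
        show "Poly_Mapping.lookup (q i) u = Poly_Mapping.lookup (r i) u"
        proof (cases "u \<in> C i")
          case True
          then show ?thesis using *[of u] single_index[of q i u] q(1) C[OF i] i r by auto
        next
          case False
          then show ?thesis using q(1)[OF i] r by (auto simp: in_keys_iff)
        qed
      qed
      then show "w = (\<lambda>i\<in>T. I +>\<^bsub>mpoly_ring\<^esub> r i)" unfolding w_eq by (auto intro: restrict_ext)
    qed
  qed
qed

section \<open>Cyclic parts, freeness and homogeneous generators\<close>

lemma cyclic_part_single:
  assumes "c \<noteq> 0"
  shows "cyclic_part (quot_module J I) (I +>\<^bsub>mpoly_ring\<^esub> Poly_Mapping.single a c) Z = coset_span (cone a Z)"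
proof -
  have "cyclic_part (quot_module J I) (I +>\<^bsub>mpoly_ring\<^esub> Poly_Mapping.single a c) Z =
      (\<lambda>q. I +>\<^bsub>mpoly_ring\<^esub> q) ` (\<lambda>f. f * Poly_Mapping.single a c) ` poly_in Z"
    by (auto simp: cyclic_part_def quot_module_simps[OF mI mJ IJ])
  then show ?thesis
    unfolding poly_in_times_single[OF assms] by (auto simp: coset_span_def)
qed

lemma cyclic_part_zero: "cyclic_part (quot_module J I) I Z = coset_span {}"
proof -
  have "f \<odot>\<^bsub>quot_module J I\<^esub> I = I" for f
    using quot_module_simps(4)[OF mI mJ IJ, of f 0] by (simp add: coset_zero[OF mI])
  moreover have "0 \<in> poly_in Z" by (simp add: poly_in_def)
  ultimately have "cyclic_part (quot_module J I) I Z = {I}" unfolding cyclic_part_def by auto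
  moreover have "coset_span {} = {I}" by (simp add: coset_span_def coset_zero[OF mI])
  ultimately show ?thesis by simp
qed

text \<open>
  A basis element has the form \<open>f m\<close>, so a monomial of \<open>K[Z]\<close> that annihilates \<open>m\<close> also annihilates
  the whole basis.
\<close>

lemma free_over_cyclic_part_nonzero:
  assumes free: "free_over (poly_in Z) (quot_module J I)
      (cyclic_part (quot_module J I) (I +>\<^bsub>mpoly_ring\<^esub> q) Z)"
    and qJ: "q \<in> J" and q: "q \<notin> I" and b: "Poly_Mapping.keys b \<subseteq> Z"
  shows "Poly_Mapping.single b 1 * q \<notin> I"
proof
  assume bq: "Poly_Mapping.single b 1 * q \<in> I"
  let ?M = "quot_module J I"
  let ?N = "cyclic_part (quot_module J I) (I +>\<^bsub>mpoly_ring\<^esub> q) Z"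
  interpret abelian_group ?M by (rule abelian_group_quot_module[OF mI mJ IJ])
  obtain B where B: "B \<subseteq> ?N"
    "\<forall>F c. finite F \<and> F \<subseteq> B \<and> c \<in> F \<rightarrow> poly_in Z \<and> (\<Oplus>\<^bsub>?M\<^esub>b\<in>F. c b \<odot>\<^bsub>?M\<^esub> b) = \<zero>\<^bsub>?M\<^esub> \<longrightarrow>
        (\<forall>b\<in>F. c b = 0)"
    "\<forall>x\<in>?N. \<exists>F c. finite F \<and> F \<subseteq> B \<and> c \<in> F \<rightarrow> poly_in Z \<and> x = (\<Oplus>\<^bsub>?M\<^esub>b\<in>F. c b \<odot>\<^bsub>?M\<^esub> b)"
    using free unfolding free_over_def by (elim exE conjE) (rule that; assumption)
  have "I +>\<^bsub>mpoly_ring\<^esub> q \<in> ?N"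
    unfolding cyclic_part_def mem_Collect_eq
    by (rule exI[of _ 1]) (simp add: poly_in_def quot_module_simps(4)[OF mI mJ IJ])
  from B(3)[rule_format, OF this] obtain F c where
    F: "F \<subseteq> B" "I +>\<^bsub>mpoly_ring\<^esub> q = (\<Oplus>\<^bsub>?M\<^esub>b\<in>F. c b \<odot>\<^bsub>?M\<^esub> b)" by blast
  \<comment> \<open>The class of \<open>q\<close> is nonzero, so the basis is not empty; a single
    annihilated basis element already contradicts independence.\<close>
  have "F \<noteq> {}"
  proof
    assume "F = {}"
    then have "I +>\<^bsub>mpoly_ring\<^esub> q = I" using F(2) by (simp add: quot_module_simps(2)[OF mI mJ IJ])
    then show False using q by (simp add: coset_eq_I_iff[OF mI])
  qed
  then obtain x where x: "x \<in> B" using F(1) by blast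
  then obtain f where f: "x = I +>\<^bsub>mpoly_ring\<^esub> (f * q)"
    using B(1) by (auto simp: cyclic_part_def quot_module_simps[OF mI mJ IJ])
  have "Poly_Mapping.single b 1 * (f * q) \<in> I"
    using monomial_ideal_closed(3)[OF mI bq, of f] by (simp add: mult_ac)
  then have "Poly_Mapping.single b 1 \<odot>\<^bsub>?M\<^esub> x = \<zero>\<^bsub>?M\<^esub>"
    unfolding f quot_module_simps[OF mI mJ IJ] by (simp add: coset_eq_I_iff[OF mI])
  then have "(\<Oplus>\<^bsub>?M\<^esub>y\<in>{x}. Poly_Mapping.single b 1 \<odot>\<^bsub>?M\<^esub> y) = \<zero>\<^bsub>?M\<^esub>"
    by simp
  then have "Poly_Mapping.single b (1::'k) = 0"
    using B(2)[rule_format, of "{x}" "\<lambda>_. Poly_Mapping.single b 1" x] x b by (simp add: poly_in_def)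
  then show False by (metis lookup_single_eq lookup_zero zero_neq_one)
qed

text \<open>The generator alone is a basis: its multiples by elements of \<open>K[Z]\<close> are
  supported in the cone, which avoids \<open>I\<close>, and multiplication by a monomial is
  injective.\<close>

lemma free_over_cyclic_part_single:
  assumes "cone a Z \<subseteq> exps J - exps I"
  shows "free_over (poly_in Z) (quot_module J I)
    (cyclic_part (quot_module J I) (I +>\<^bsub>mpoly_ring\<^esub> Poly_Mapping.single a 1) Z)"
proof -
  let ?M = "quot_module J I"
  let ?m = "I +>\<^bsub>mpoly_ring\<^esub> Poly_Mapping.single a (1::'k)"
  let ?N = "cyclic_part ?M ?m Z"
  interpret abelian_group ?M by (rule abelian_group_quot_module[OF mI mJ IJ])
  have aJ: "Poly_Mapping.single a (1::'k) \<in> J" using assms cone_self[of a Z] by (auto simp: exps_def)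
  have carrier: "f \<odot>\<^bsub>?M\<^esub> ?m \<in> carrier ?M" for f
    using monomial_ideal_closed(3)[OF mJ aJ] by (auto simp: quot_module_simps[OF mI mJ IJ])
  have one: "1 \<odot>\<^bsub>?M\<^esub> ?m = ?m" by (simp add: quot_module_simps(4)[OF mI mJ IJ])
  have sub: "{?m} \<subseteq> ?N"
    using one by (auto simp: cyclic_part_def poly_in_def intro!: exI[of _ 1])
  have indep: "\<forall>b\<in>F. c b = 0"
    if F: "F \<subseteq> {?m}" "c \<in> F \<rightarrow> poly_in Z" "(\<Oplus>\<^bsub>?M\<^esub>b\<in>F. c b \<odot>\<^bsub>?M\<^esub> b) = \<zero>\<^bsub>?M\<^esub>" for F c
  proof
    fix b assume b: "b \<in> F"
    then have Fb: "F = {?m}" "b = ?m" using F(1) by auto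
    let ?f = "c ?m"
    have f: "?f \<in> poly_in Z" using F(2) Fb by auto
    have "?f \<odot>\<^bsub>?M\<^esub> ?m = \<zero>\<^bsub>?M\<^esub>" using F(3) carrier unfolding Fb by simp
    then have "?f * Poly_Mapping.single a 1 \<in> I"
      by (simp add: quot_module_simps[OF mI mJ IJ] coset_eq_I_iff[OF mI])
    moreover have "?f * Poly_Mapping.single a 1 \<in> {q. Poly_Mapping.keys q \<subseteq> cone a Z}"
      by (subst poly_in_times_single[symmetric]) (use f in auto)
    ultimately have "Poly_Mapping.keys (?f * Poly_Mapping.single a 1) = {}"
      using assms mem_monomial_ideal_iff[OF mI] by blast
    then have "?f * Poly_Mapping.single a 1 = 0" by simp
    then have "Poly_Mapping.lookup ?f u = 0" for u
      using lookup_times_single[of ?f a 1 u] by simp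
    then show "c b = 0" unfolding Fb by (intro poly_mapping_eqI) simp
  qed
  have gen: "\<exists>F c. finite F \<and> F \<subseteq> {?m} \<and> c \<in> F \<rightarrow> poly_in Z \<and> x = (\<Oplus>\<^bsub>?M\<^esub>b\<in>F. c b \<odot>\<^bsub>?M\<^esub> b)"
    if x: "x \<in> ?N" for x
  proof -
    obtain f where "f \<in> poly_in Z" "x = f \<odot>\<^bsub>?M\<^esub> ?m" using x by (auto simp: cyclic_part_def)
    then show ?thesis
      using carrier by (intro exI[of _ "{?m}"] exI[of _ "\<lambda>_. f"]) simp
  qed
  show ?thesis
    unfolding free_over_def
    by (intro exI[of _ "{?m}"] conjI allI ballI impI sub gen) (elim conjE, rule indep[THEN bspec])
qed

text \<open>A degree in the fine grading determines the exponent vector, so a homogeneous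
  representative has at most one term; \<open>c = 0\<close> covers the zero polynomial.\<close>

lemma homogeneous_obtains_single:
  assumes "homogeneous (quot_grading J I) m"
  obtains a c where "m = I +>\<^bsub>mpoly_ring\<^esub> Poly_Mapping.single a c" "Poly_Mapping.single a c \<in> J"
proof -
  obtain d q where q: "q \<in> J" "m = I +>\<^bsub>mpoly_ring\<^esub> q"
    "\<And>a i. a \<in> Poly_Mapping.keys q \<Longrightarrow> int (Poly_Mapping.lookup a i) = d i"
    using assms by (auto simp: homogeneous_def quot_grading_def)
  have "\<exists>a c. q = Poly_Mapping.single a c"
  proof (cases "q = 0")
    case False
    then obtain a where a: "a \<in> Poly_Mapping.keys q" by fastforce
    have "b = a" if "b \<in> Poly_Mapping.keys q" for b
      by (rule poly_mapping_eqI) (metis q(3) a that of_nat_eq_iff)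
    then have "Poly_Mapping.keys q = {a}" using a by blast
    then show ?thesis using poly_eq_sum_single[of q] by auto
  qed (metis single_zero)
  then show ?thesis using q that by blast
qed

text \<open>
  The case \<open>C = {}\<close> belongs to \<open>m = 0\<close>, which \<^const>\<open>Stanley_decomposition\<close> admits because the zero
  module is free.
\<close>

lemma stanley_summand:
  assumes m: "homogeneous (quot_grading J I) m"
    and free: "free_over (poly_in Z) (quot_module J I) (cyclic_part (quot_module J I) m Z)"
  shows "\<exists>C. cyclic_part (quot_module J I) m Z = coset_span C \<and> C \<subseteq> exps J - exps I \<and>
    (C = {} \<or> (\<exists>a. C = cone a Z))"
proof -
  obtain a c where ac: "m = I +>\<^bsub>mpoly_ring\<^esub> Poly_Mapping.single a c" "Poly_Mapping.single a c \<in> J"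
    using homogeneous_obtains_single[OF m] .
  show ?thesis
  proof (cases "Poly_Mapping.single a c \<in> I")
    case True
    then have "m = I" using ac coset_eq_I_iff[OF mI] by simp
    then show ?thesis using cyclic_part_zero by (intro exI[of _ "{}"]) simp
  next
    case False
    then have c: "c \<noteq> 0" using monomial_ideal_closed(1)[OF mI] by auto
    \<comment> \<open>The cone stays in \<open>J\<close> because \<open>J\<close> is an ideal; it
      avoids \<open>I\<close> because of freeness.\<close>
    have "cone a Z \<subseteq> exps J - exps I"
    proof
      fix u assume "u \<in> cone a Z"
      then obtain b where b: "u = b + a" "Poly_Mapping.keys b \<subseteq> Z"
        by (auto simp: cone_def add.commute)
      have eq: "Poly_Mapping.single b 1 * Poly_Mapping.single a c = Poly_Mapping.single u c"
        by (simp add: b mult_single)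
      have "Poly_Mapping.single u c \<in> J"
        using monomial_ideal_closed(3)[OF mJ ac(2), of "Poly_Mapping.single b 1"] eq by simp
      moreover have "Poly_Mapping.single u c \<notin> I"
        using free_over_cyclic_part_nonzero[OF free[unfolded ac(1)] ac(2) False b(2)] eq by simp
      ultimately show "u \<in> exps J - exps I"
        using single_mem_monomial_ideal_iff[OF mI c] single_mem_monomial_ideal_iff[OF mJ c] by blast
    qed
    then show ?thesis unfolding ac(1) using cyclic_part_single[OF c] by blast
  qed
qed

section \<open>Passage between Stanley decompositions and cone partitions\<close>

text \<open>Zero summands give the empty set, which is not a part of any partition; deleting it is
  why the length is only an upper bound.\<close>

lemma Stanley_decomposition_imp_cone_partition:
  assumes D: "Stanley_decomposition (quot_module J I) (quot_grading J I) D"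
  shows "\<exists>P. cone_partition (exps J - exps I) P \<and> card P \<le> length D"
proof -
  let ?M = "quot_module J I"
  let ?X = "{..<length D}"
  have "\<exists>C. cyclic_part ?M (fst (D ! i)) (snd (D ! i)) = coset_span C \<and> C \<subseteq> exps J - exps I \<and>
      (C = {} \<or> (\<exists>a. C = cone a (snd (D ! i))))" if "i \<in> ?X" for i
  proof -
    have "D ! i \<in> set D" using that by simp
    then have "homogeneous (quot_grading J I) (fst (D ! i)) \<and>
        free_over (poly_in (snd (D ! i))) ?M (cyclic_part ?M (fst (D ! i)) (snd (D ! i)))"
      using D unfolding Stanley_decomposition_def split_beta by blast
    then show ?thesis using stanley_summand by blast
  qed
  then obtain C where C:
    "\<And>i. i \<in> ?X \<Longrightarrow> cyclic_part ?M (fst (D ! i)) (snd (D ! i)) = coset_span (C i)"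
    "\<And>i. i \<in> ?X \<Longrightarrow> C i \<subseteq> exps J - exps I"
    "\<And>i. i \<in> ?X \<Longrightarrow> C i = {} \<or> (\<exists>a. C i = cone a (snd (D ! i)))"
    by metis
  have "direct_sum_of ?M ?X (\<lambda>i. cyclic_part ?M (fst (D ! i)) (snd (D ! i)))"
    using D by (simp add: Stanley_decomposition_def)
  then have "direct_sum_of ?M ?X (\<lambda>i. coset_span (C i))"
    by (rule direct_sum_of_cong[THEN iffD1, rotated]) (use C(1) in simp)
  then have dc: "disjoint_family_on C ?X" "(\<Union>i\<in>?X. C i) = exps J - exps I"
    using direct_sum_of_coset_span_iff[of ?X C] C(2) by auto
  let ?P = "C ` ?X - {{}}"
  have "partition_on (exps J - exps I) ?P"
  proof (rule partition_onI)
    show "\<Union>?P = exps J - exps I" unfolding dc(2)[symmetric] by blast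
    show "disjnt p q" if pq: "p \<in> ?P" "q \<in> ?P" "p \<noteq> q" for p q
    proof -
      obtain i j where ij: "i \<in> ?X" "j \<in> ?X" "p = C i" "q = C j" using pq(1,2) by blast
      then have "i \<noteq> j" using pq(3) by blast
      then show ?thesis
        using disjoint_family_onD[OF dc(1) ij(1,2)] ij(3,4) by (simp add: disjnt_def)
    qed
  qed simp
  moreover have "\<exists>a Z. E = cone a Z" if "E \<in> ?P" for E
    using that C(3) by blast
  ultimately have "cone_partition (exps J - exps I) ?P"
    by (simp add: cone_partition_def)
  moreover have "card ?P \<le> length D"
    using card_mono[of "C ` ?X" ?P] card_image_le[of ?X C] by auto
  ultimately show ?thesis by blast
qed

text \<open>Each cone yields the summand generated by the class of its least monomial, so the number
  of parts is kept exactly.\<close>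

lemma cone_partition_imp_Stanley_decomposition:
  assumes P: "cone_partition (exps J - exps I) P"
  shows "\<exists>D. Stanley_decomposition (quot_module J I) (quot_grading J I) D \<and> length D = card P"
proof -
  let ?M = "quot_module J I"
  have "finite P" using P by (simp add: cone_partition_def)
  then obtain xs where xs: "set xs = P" "distinct xs" using finite_distinct_list by blast
  have "\<exists>a Z. cone a Z = C" if "C \<in> P" for C
  proof -
    have "\<exists>a Z. C = cone a Z" using P that by (simp add: cone_partition_def)
    then show ?thesis by (elim exE) (rule exI, rule exI, erule sym)
  qed
  then obtain a Z where aZ: "\<And>C. C \<in> P \<Longrightarrow> cone (a C) (Z C) = C" by metis
  have union: "\<Union>P = exps J - exps I" and disj: "disjoint P"
    using P by (auto simp: cone_partition_def partition_on_def)
  have sub: "cone (a C) (Z C) \<subseteq> exps J - exps I" if "C \<in> P" for C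
    unfolding aZ[OF that] using union that by blast
  define D where "D = map (\<lambda>C. (I +>\<^bsub>mpoly_ring\<^esub> Poly_Mapping.single (a C) (1::'k), Z C)) xs"
  let ?X = "{..<length D}"
  have "direct_sum_of ?M ?X (\<lambda>i. coset_span (xs ! i))"
  proof (rule direct_sum_of_coset_span_iff[THEN iffD2], goal_cases)
    case (2 i)
    then have "xs ! i \<in> P" using xs(1) by (auto simp: D_def)
    then show ?case using union by blast
  next
    case 3
    have "disjoint_family_on ((!) xs) ?X"
      unfolding disjoint_family_on_def
    proof (intro ballI impI)
      fix i j assume "i \<in> ?X" "j \<in> ?X" "i \<noteq> j"
      then have "xs ! i \<in> P" "xs ! j \<in> P" "xs ! i \<noteq> xs ! j"
        using xs by (auto simp: D_def nth_eq_iff_index_eq)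
      then show "xs ! i \<inter> xs ! j = {}"
        using disjointD[OF disj] by blast
    qed
    moreover have "(\<Union>i\<in>?X. xs ! i) = \<Union> (set xs)" by (auto simp: D_def set_conv_nth)
    ultimately show ?case using union xs(1) by simp
  qed simp
  then have "direct_sum_of ?M ?X (\<lambda>i. cyclic_part ?M (fst (D ! i)) (snd (D ! i)))"
  proof (rule direct_sum_of_cong[THEN iffD1, rotated])
    fix i assume "i \<in> ?X"
    then have i: "i < length xs" by (simp add: D_def)
    then show "coset_span (xs ! i) = cyclic_part ?M (fst (D ! i)) (snd (D ! i))"
      using aZ[of "xs ! i"] nth_mem[OF i] xs(1) by (simp add: D_def cyclic_part_single)
  qed
  moreover have "m \<in> carrier ?M \<and> homogeneous (quot_grading J I) m \<and>
      free_over (poly_in Z') ?M (cyclic_part ?M m Z')" if "(m, Z') \<in> set D" for m Z'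
  proof -
    obtain C where C: "C \<in> P" "m = I +>\<^bsub>mpoly_ring\<^esub> Poly_Mapping.single (a C) 1" "Z' = Z C"
      using \<open>(m, Z') \<in> set D\<close> xs(1) by (auto simp: D_def)
    have aJ: "Poly_Mapping.single (a C) (1::'k) \<in> J"
      using sub[OF C(1)] cone_self[of "a C" "Z C"] by (auto simp: exps_def)
    have "m \<in> quot_grading J I (\<lambda>i. int (Poly_Mapping.lookup (a C) i))"
      using aJ C(2) by (auto simp: quot_grading_def intro!: exI[of _ "Poly_Mapping.single (a C) 1"])
    moreover have "m \<in> carrier ?M" using aJ C(2) by (auto simp: quot_module_simps[OF mI mJ IJ])
    ultimately show ?thesis
      using free_over_cyclic_part_single[OF sub[OF C(1)]] C by (auto simp: homogeneous_def)
  qed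
  ultimately have "Stanley_decomposition ?M (quot_grading J I) D"
    by (auto simp: Stanley_decomposition_def)
  moreover have "length D = card P" using xs distinct_card by (fastforce simp: D_def)
  ultimately show ?thesis by blast
qed

lemma slength_le_card:
  assumes "cone_partition (exps J - exps I) P"
  shows "slength (quot_module J I) (quot_grading J I) \<le> card P"
  unfolding slength_def
  by (rule Least_le) (use cone_partition_imp_Stanley_decomposition[OF assms] in blast)

lemma ex_cone_partition_card_le_slength:
  "\<exists>P. cone_partition (exps J - exps I) P \<and> card P \<le> slength (quot_module J I) (quot_grading J I)"
proof -
  obtain P where "cone_partition (exps J - exps I) P"
    using ex_cone_partition[OF upset_exps[OF mJ] upset_exps[OF mI]] by blast
  then obtain D where "Stanley_decomposition (quot_module J I) (quot_grading J I) D"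
    using cone_partition_imp_Stanley_decomposition by blast
  then have "\<exists>r D. Stanley_decomposition (quot_module J I) (quot_grading J I) D \<and> length D = r"
    by (intro exI conjI) (assumption, rule refl)
  \<comment> \<open>Existence makes the minimum attained, so a decomposition of length exactly
    \<open>slength\<close> is available for translation.\<close>
  from LeastI_ex[OF this] obtain D' where
    D': "Stanley_decomposition (quot_module J I) (quot_grading J I) D'"
      "length D' = slength (quot_module J I) (quot_grading J I)"
    unfolding slength_def[symmetric] by (elim exE conjE) (rule that; assumption)
  show ?thesis using Stanley_decomposition_imp_cone_partition[OF D'(1)] unfolding D'(2) .
qed

end

theorem theorem2p11:
  fixes I1 J1 I2 J2 :: "('n::finite, 'k::field) mpoly set"
    and \<Phi> :: "('n, 'k) mpoly \<Rightarrow> ('n, 'k) mpoly"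
  assumes "monomial_ideal I1" and "monomial_ideal J1" and "I1 \<subset> J1"
    and "monomial_ideal I2" and "monomial_ideal J2" and "I2 \<subset> J2"
    and "\<Phi> \<in> Mon \<rightarrow> Mon"
    and "\<And>u. u \<in> Mon \<Longrightarrow> u \<in> I1 \<longleftrightarrow> \<Phi> u \<in> I2"
    and "\<And>u. u \<in> Mon \<Longrightarrow> u \<in> J1 \<longleftrightarrow> \<Phi> u \<in> J2"
    and "\<And>u Z v. u \<in> Mon \<Longrightarrow> v \<in> Mon \<Longrightarrow>
           v \<in> Stanley_space u Z \<longleftrightarrow> \<Phi> v \<in> Stanley_space (\<Phi> u) Z"
  shows "slength (quot_module J1 I1) (quot_grading J1 I1)
           \<le> slength (quot_module J2 I2) (quot_grading J2 I2)"
proof -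
  have Mon: "Poly_Mapping.single a (1::'k) \<in> Mon" for a :: "'n \<Rightarrow>\<^sub>0 nat" by (auto simp: Mon_def)
  have "\<forall>a. \<exists>b. \<Phi> (Poly_Mapping.single a 1) = Poly_Mapping.single b 1"
    using assms(7) Mon by (fastforce simp: Mon_def)
  then obtain \<phi> where \<phi>: "\<And>a. \<Phi> (Poly_Mapping.single a 1) = Poly_Mapping.single (\<phi> a) 1" by metis
  have cone: "v \<in> cone u Z \<longleftrightarrow> \<phi> v \<in> cone (\<phi> u) Z" for u v Z
    using assms(10)[OF Mon Mon, of v u Z] by (simp add: \<phi> single_in_Stanley_space_iff)
  \<comment> \<open>The equivalences in (i) and (ii) give equality here, so the pulled-back cones
    cover the monomials of \<open>J1\<close> outside \<open>I1\<close> and nothing else.\<close>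
  have exps: "exps J1 - exps I1 = \<phi> -` (exps J2 - exps I2)"
    using assms(8,9)[OF Mon] by (auto simp: exps_def \<phi>)
  obtain P where P: "cone_partition (exps J2 - exps I2) P"
    "card P \<le> slength (quot_module J2 I2) (quot_grading J2 I2)"
    using ex_cone_partition_card_le_slength[OF assms(4,5)] assms(6) by blast
  obtain Q where Q: "cone_partition (exps J1 - exps I1) Q" "card Q \<le> card P"
    using cone_partition_vimage[OF cone P(1)] unfolding exps by blast
  have "slength (quot_module J1 I1) (quot_grading J1 I1) \<le> card Q"
    using slength_le_card[OF assms(1,2) _ Q(1)] assms(3) by blast
  then show ?thesis using Q(2) P(2) by simp
qed

end
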